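(* Let $d\ge 3$ be an integer and let $(N_2(N_1))_{N_1\ge 1}$ be a sequence of positive integers such that $N_1\ge N_2(N_1)$ for all $N_1$. For each $N_1$, let $\Gamma_1$ and $\Gamma_2$ be two independent uniform random $d$-hypergraphs with respectively $N_1$ and $N_2(N_1)$ vertices. 1. If $\liminf_{N_1\to\infty}\frac{\log_2(N_2(N_1))}{(\log_2 N_1)^{1-\frac{1}{d-1}}}>0$, then w.h.p. the largest common induced subgraph of $\Gamma_1$ and $\Gamma_2$ has size either $\lfloor x_{N_1}-(\log_2 N_1)^{-1/d}\rfloor$ or $\lfloor x_{N_1}+(\log_2 N_1)^{-1/d}\rfloor$, where $$x_{N_1}=\left(d!\,\log_2(N_1N_2(N_1))\right)^{\frac{1}{d-1}}+\frac d2 .$$ 2. Assume on the contrary that $\log_2(N_2(N_1))=o\left((\log_2 N_1)^{1-\frac1{d-1}}\right)$ as $N_1\to\infty$. (a) If for all $N_1$ large enough $$N_2(N_1)>\left\lfloor (d!\log_2 N_1)^{\frac1{d-1}}+\frac d2-(\log_2 N_1)^{-\frac1d}\right\rfloor ,$$ then there exists a positive sequence $(\mu_{N_1})_{N_1\ge1}$ with limit $0$ such that w.h.p. the largest common induced subgraph of $\Gamma_1$ and $\Gamma_2$ has size either $\lfloor y_{N_1}-\mu_{N_1}\rfloor$ or $\lfloor y_{N_1}+\mu_{N_1}\rfloor$, where $$y_{N_1}=(d!\log_2 N_1)^{\frac1{d-1}}+\frac d2 .$$ (b) If for all $N_1$ large enough $$N_2(N_1)\le\left\lfloor (d!\log_2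 N_1)^{\frac1{d-1}}+\frac d2-(\log_2 N_1)^{-\frac1d}\right\rfloor ,$$ then w.h.p. $\Gamma_2$ is an induced subgraph of $\Gamma_1$.
   Context: A $d$-hypergraph $G=(V,E)$ consists of a finite set $V$ of vertices and a set $E$ of hyperedges, each a subset of $V$ of size $d$. A uniform random $d$-hypergraph with $M$ vertices is a random $d$-hypergraph on $\{1,\dots,M\}$ in which each of the $\binom Md$ possible hyperedges is present independently with probability $1/2$. For a $k$-tuple $I=(i_1,\dots,i_k)$ of distinct vertices of $G$, the induced subgraph $G_I$ is the $d$-hypergraph with vertex set $\{1,\dots,k\}$ such that a $d$-subset $J\subset\{1,\dots,k\}$ is a hyperedge of $G_I$ if and only if $\{i_j : j\in J\}$ is a hyperedge of $G$. The size of the largest common induced subgraph of $\Gamma_1$ and $\Gamma_2$ is the largest $k$ for which there exist $k$-tuples $I$ of distinct vertices of $\Gamma_1$ and $J$ of distinct vertices of $\Gamma_2$ with $\Gamma_{1,I}=\Gamma_{2,J}$ (where $\Gamma_{1,I}=(\Gamma_1)_I$ and $\Gamma_{2,J}=(\Gamma_2)_J$). "$\Gamma_2$ is an induced subgraph of $\Gamma_1$" means that there is an $N_2(N_1)$-tuple $I$ of distinct vertices of $\Gamma_1$ with $\Gamma_{1,I}=\Gamma_2$. "W.h.p." means that the probability of the event tends to $1$ as $N_1\to\infty$. *)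

theory Defs
  imports "HOL-Probability.Probability" "HOL-Library.Landau_Symbols"
begin

datatype 'a hypergraph = Hypergraph (verts: "'a set") (hedges: "'a set set")

definition d_hypergraph :: "nat \<Rightarrow> 'a hypergraph \<Rightarrow> bool" where
  "d_hypergraph d G \<longleftrightarrow>
     finite (verts G) \<and> hedges G \<subseteq> {e. e \<subseteq> verts G \<and> card e = d}"

text \<open>A \<open>k\<close>-tuple is a function of which only the values on \<open>{1..k}\<close> matter.\<close>

definition vertex_tuple :: "'a hypergraph \<Rightarrow> nat \<Rightarrow> (nat \<Rightarrow> 'a) \<Rightarrow> bool" where
  "vertex_tuple G k I \<longleftrightarrow> inj_on I {1..k} \<and> I ` {1..k} \<subseteq> verts G"

definition induced_subgraph ::
    "nat \<Rightarrow> 'a hypergraph \<Rightarrow> nat \<Rightarrow> (nat \<Rightarrow> 'a) \<Rightarrow> nat hypergraph" where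
  "induced_subgraph d G k I =
     Hypergraph {1..k} {J. J \<subseteq> {1..k} \<and> card J = d \<and> I ` J \<in> hedges G}"

definition common_sizes :: "nat \<Rightarrow> 'a hypergraph \<Rightarrow> 'b hypergraph \<Rightarrow> nat set" where
  "common_sizes d G H =
     {k. \<exists>I J. vertex_tuple G k I \<and> vertex_tuple H k J \<and>
               induced_subgraph d G k I = induced_subgraph d H k J}"

text \<open>\<open>Max\<close> is meaningful here: see \<open>common_sizes_finite\<close> and \<open>zero_in_common_sizes\<close>.\<close>

definition largest_common_size :: "nat \<Rightarrow> 'a hypergraph \<Rightarrow> 'b hypergraph \<Rightarrow> nat" where
  "largest_common_size d G H = Max (common_sizes d G H)"

lemma zero_in_common_sizes: "0 < d \<Longrightarrow> 0 \<in> common_sizes d G H"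
  by (force simp: common_sizes_def vertex_tuple_def induced_subgraph_def cong: conj_cong)

lemma common_sizes_finite:
  assumes "d_hypergraph d G"
  shows "finite (common_sizes d G H)"
proof (rule finite_subset)
  show "common_sizes d G H \<subseteq> {..card (verts G)}"
  proof
    fix k assume "k \<in> common_sizes d G H"
    then obtain I where "inj_on I {1..k}" "I ` {1..k} \<subseteq> verts G"
      by (auto simp: common_sizes_def vertex_tuple_def)
    with assms have "card {1..k} \<le> card (verts G)"
      unfolding d_hypergraph_def by (meson card_inj_on_le)
    then show "k \<in> {..card (verts G)}" by simp
  qed
qed simp

definition is_induced_subgraph :: "nat \<Rightarrow> nat hypergraph \<Rightarrow> 'a hypergraph \<Rightarrow> bool" where
  "is_induced_subgraph d H G \<longleftrightarrow>
     (\<exists>I. vertex_tuple G (card (verts H)) I \<and>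
          induced_subgraph d G (card (verts H)) I = H)"

definition uniform_hypergraph :: "nat \<Rightarrow> nat \<Rightarrow> nat hypergraph pmf" where
  "uniform_hypergraph d M =
     map_pmf (\<lambda>f. Hypergraph {1..M} {e. f e})
       (Pi_pmf {e. e \<subseteq> {1..M} \<and> card e = d} False (\<lambda>_. bernoulli_pmf (1/2)))"

lemma d_hypergraph_uniform:
  assumes "G \<in> set_pmf (uniform_hypergraph d M)"
  shows "verts G = {1..M}" "d_hypergraph d G"
proof -
  have "finite {e. e \<subseteq> {1..M} \<and> card e = d}" by simp
  from set_Pi_pmf_subset[OF this] assms show "verts G = {1..M}" "d_hypergraph d G"
    by (fastforce simp: uniform_hypergraph_def d_hypergraph_def)+
qed

definition whp :: "(nat \<Rightarrow> 'a pmf) \<Rightarrow> (nat \<Rightarrow> 'a \<Rightarrow> bool) \<Rightarrow> bool" where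
  "whp p P \<longleftrightarrow> (\<lambda>n. measure_pmf.prob (p n) {\<omega>. P n \<omega>}) \<longlonglongrightarrow> 1"

definition xseq :: "nat \<Rightarrow> (nat \<Rightarrow> nat) \<Rightarrow> nat \<Rightarrow> real" where
  "xseq d N2 n = (fact d * log 2 (real n * real (N2 n))) powr (1 / (real d - 1)) + real d / 2"

definition yseq :: "nat \<Rightarrow> nat \<Rightarrow> real" where
  "yseq d n = (fact d * log 2 (real n)) powr (1 / (real d - 1)) + real d / 2"

end

theory Submission
  imports Defs "HOL-Real_Asymp.Real_Asymp"
begin

text \<open>
  Write \<open>n\<close>, \<open>m\<close> for the numbers of vertices. A union bound over pairs of \<open>k\<close>-tuples shows that a
  common induced subgraph of size \<open>k\<close> exists with probability at most \<open>(n m)\<^sup>k / 2 ^ (k choose d)\<close>,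
  which is small once \<open>(k choose d) / k\<close> exceeds \<open>log 2 (n m)\<close>, that is, for \<open>k\<close> above
  \<open>(d! log 2 (n m)) powr (1 / (d - 1)) + d / 2\<close>. Just below this value a common subgraph is found by
  the second moment method, applied only to pairs of tuples whose \<open>i\<close>-th entries lie in fixed disjoint
  blocks; the number of such pairs has the same order to the precision needed. If \<open>m\<close> is so
  small that \<open>log 2 m\<close> does not matter, the second tuple is kept fixed as \<open>(1, \<dots>, k)\<close>,
  which also finds all of the second hypergraph in the first when \<open>k = m\<close>.
\<close>

text \<open>Write L = log 2 n and X = (d! l) powr (1 / (d - 1)), where l is log 2 n or log 2 (n m).
  Moving k by e near X + d / 2 moves (k choose d) / k by the order of e * X ^ (d - 2). The second
  moment method loses only a factor polynomial in k, at most 4 k^3 against 2 powr l, hence O(log L)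
  on this scale. With e = L powr (- 1 / d) this loss is negligible: X is at least L powr (1 / (d -
  1)), and d >= 3 leaves at least one factor X. For d = 2 no growing factor would be left.

  The two regimes come from comparing log 2 n with log 2 (n m): the critical sizes differ by at most
  a constant times log 2 m / L powr (1 - 1 / (d - 1)). If this ratio stays away from 0, then m
  outgrows every power of L, since the exponent is at least 1/2, and tuples of critical size fit
  into the second hypergraph. If it tends to 0, the two critical sizes merge, and the size of the
  second hypergraph matters only as an upper limit for k.\<close>

section \<open>Uniform random sets and the second moment method\<close>

text \<open>Each constraint \<open>c\<close> has a coordinate \<open>u c\<close> that no other constraint mentions, so it can be
  solved for \<open>u c\<close> once the remaining coordinates are fixed.\<close>

lemma prob_private_equalities:
  fixes W :: "'w set" and u v :: "'c \<Rightarrow> 'w"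
  assumes W: "finite W" and u: "u ` C \<subseteq> W" and v: "v ` C \<subseteq> W"
    and inj: "inj_on u C" and priv: "u ` C \<inter> v ` C = {}"
  shows "measure_pmf.prob (pmf_of_set (Pow W)) {S. \<forall>c\<in>C. u c \<in> S \<longleftrightarrow> v c \<in> S} = (1/2) ^ card C"
proof -
  let ?Q = "{S. \<forall>c\<in>C. u c \<in> S \<longleftrightarrow> v c \<in> S}"
  let ?g = "\<lambda>R. R \<union> u ` {c\<in>C. v c \<in> R}"
  have "bij_betw ?g (Pow (W - u ` C)) (Pow W \<inter> ?Q)"
  proof (rule bij_betw_byWitness[where f' = "\<lambda>S. S - u ` C"])
    show "\<forall>S\<in>Pow W \<inter> ?Q. ?g (S - u ` C) = S"
      using priv by (auto 0 3)
    show "?g ` Pow (W - u ` C) \<subseteq> Pow W \<inter> ?Q"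
    proof (intro image_subsetI IntI CollectI ballI)
      fix R c
      assume R: "R \<in> Pow (W - u ` C)" and c: "c \<in> C"
      have "v c \<notin> u ` C" using priv c by blast
      then have "v c \<in> ?g R \<longleftrightarrow> v c \<in> R" by auto
      moreover have "u c \<notin> R" using R c by auto
      then have "u c \<in> ?g R \<longleftrightarrow> u c \<in> u ` {c\<in>C. v c \<in> R}"
        by simp
      moreover have "u c \<in> u ` {c\<in>C. v c \<in> R} \<longleftrightarrow> v c \<in> R"
        using inj c by (subst inj_on_image_mem_iff) auto
      ultimately show "u c \<in> ?g R \<longleftrightarrow> v c \<in> ?g R"
        by simp
    qed (use u in auto)
    show "(\<lambda>S. S - u ` C) ` (Pow W \<inter> ?Q) \<subseteq> Pow (W - u ` C)"
      by auto
    show "\<forall>R\<in>Pow (W - u ` C). ?g R - u ` C = R"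
      by auto
  qed
  then have "card (Pow W \<inter> ?Q) = 2 ^ card (W - u ` C)"
    using W by (simp add: bij_betw_same_card[symmetric] card_Pow)
  also have "card (W - u ` C) = card W - card C"
    using u inj W by (metis card_Diff_subset card_image finite_subset)
  finally have card: "card (Pow W \<inter> ?Q) = 2 ^ (card W - card C)" .
  have le: "card C \<le> card W"
    using u inj W by (metis card_image card_mono)
  have "measure_pmf.prob (pmf_of_set (Pow W)) ?Q = real (card (Pow W \<inter> ?Q)) / real (card (Pow W))"
    using W by (intro measure_pmf_of_set) auto
  also have "\<dots> = 2 ^ (card W - card C) / 2 ^ card W"
    unfolding card using W by (simp add: card_Pow)
  also have "\<dots> = (1/2) ^ card C"
    using le by (simp add: power_diff power_one_over)
  finally show ?thesis .
qed

text \<open>Cauchy-Schwarz for the number Z of events that occur and the indicator of their union U,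
  as Z vanishes outside U. It is read off from the quadratic \<open>l\<close> \<mapsto> E (l 1_U -
  Z)^2 >= 0 at its minimum l = E Z / P U.\<close>

lemma second_moment:
  fixes p :: "'a pmf" and A :: "'t \<Rightarrow> 'a set"
  assumes T: "finite T"
  shows "(\<Sum>t\<in>T. measure_pmf.prob p (A t))\<^sup>2
       \<le> measure_pmf.prob p (\<Union>t\<in>T. A t) * (\<Sum>s\<in>T. \<Sum>t\<in>T. measure_pmf.prob p (A s \<inter> A t))"
proof -
  let ?P = "measure_pmf.prob p"
  define U where "U = (\<Union>t\<in>T. A t)"
  define a where "a = (\<Sum>t\<in>T. ?P (A t))"
  define b where "b = (\<Sum>s\<in>T. \<Sum>t\<in>T. ?P (A s \<inter> A t))"
  have quad: "0 \<le> l\<^sup>2 * ?P U - 2 * l * a + b" for l :: real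
  proof -
    let ?Z = "\<lambda>x. \<Sum>t\<in>T. indicator (A t) x :: real"
    have eq: "(l * indicator U x - ?Z x)\<^sup>2
        = l\<^sup>2 * indicator U x - 2 * l * ?Z x + (\<Sum>s\<in>T. \<Sum>t\<in>T. indicator (A s \<inter> A t) x)" for x
    proof -
      have UZ: "indicator U x * ?Z x = ?Z x"
        by (cases "x \<in> U") (auto simp: U_def indicator_def)
      have "(\<Sum>s\<in>T. \<Sum>t\<in>T. indicator (A s \<inter> A t) x) = ?Z x * ?Z x"
        by (simp add: sum_product indicator_inter_arith)
      moreover have "(indicator U x)\<^sup>2 = (indicator U x :: real)"
        by (simp add: indicator_def)
      ultimately show ?thesis
        using UZ by (simp add: power2_diff power_mult_distrib power2_eq_square[of "?Z x"] mult.assoc)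
    qed
    have "0 \<le> measure_pmf.expectation p (\<lambda>x. (l * indicator U x - ?Z x)\<^sup>2)"
      by (rule Bochner_Integration.integral_nonneg) simp
    also have "\<dots> = l\<^sup>2 * ?P U - 2 * l * a + b"
      unfolding eq a_def b_def
      by (subst Bochner_Integration.integral_add Bochner_Integration.integral_diff
            Bochner_Integration.integral_sum; (simp add: measure_pmf.emeasure_eq_measure)?)+
    finally show ?thesis .
  qed
  show ?thesis
  proof (cases "?P U = 0")
    case True
    have "?P (A t) = 0" if "t \<in> T" for t
    proof -
      have "?P (A t) \<le> ?P U"
        using that by (intro measure_pmf.finite_measure_mono) (auto simp: U_def)
      with True show ?thesis by (simp add: measure_le_0_iff)
    qed
    then show ?thesis using True by (simp add: U_def)
  next
    case False
    then have "?P U > 0" by (simp add: zero_less_measure_iff)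
    with quad[of "a / ?P U"] show ?thesis
      unfolding U_def[symmetric] a_def[symmetric] b_def[symmetric]
      by (simp add: field_simps power2_eq_square)
  qed
qed

section \<open>Matching tuples in a random pair\<close>

definition dsubsets :: "nat \<Rightarrow> nat \<Rightarrow> nat set set" where
  "dsubsets d M = {e. e \<subseteq> {1..M} \<and> card e = d}"

lemma finite_dsubsets [simp]: "finite (dsubsets d M)"
  by (simp add: dsubsets_def)

lemma card_dsubsets [simp]: "card (dsubsets d M) = M choose d"
  using n_subsets[of "{1..M}" d] by (simp add: dsubsets_def)

lemma image_in_dsubsets:
  assumes "e \<in> dsubsets d k" "inj_on I {1..k}" "I ` {1..k} \<subseteq> {1..n}"
  shows "I ` e \<in> dsubsets d n"
proof -
  have "e \<subseteq> {1..k}" "card e = d" using assms(1) by (auto simp: dsubsets_def)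
  moreover have "card (I ` e) = card e"
    using assms(2) \<open>e \<subseteq> {1..k}\<close> by (meson card_image inj_on_subset)
  ultimately show ?thesis using assms(3) by (auto simp: dsubsets_def)
qed

lemma pair_pmf_of_set:
  assumes "finite A" "A \<noteq> {}" "finite B" "B \<noteq> {}"
  shows "pair_pmf (pmf_of_set A) (pmf_of_set B) = pmf_of_set (A \<times> B)"
proof (rule pmf_eqI)
  fix x :: "'a \<times> 'b"
  show "pmf (pair_pmf (pmf_of_set A) (pmf_of_set B)) x = pmf (pmf_of_set (A \<times> B)) x"
    using assms by (cases x) (simp add: pmf_pair indicator_def)
qed

lemma uniform_hypergraph_eq:
  "uniform_hypergraph d M = map_pmf (Hypergraph {1..M}) (pmf_of_set (Pow (dsubsets d M)))"
proof -
  let ?P = "Pi_pmf (dsubsets d M) False (\<lambda>_. bernoulli_pmf (1/2))"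
  \<comment> \<open>On the support, the default value \<open>False\<close> of \<open>Pi_pmf\<close>
    rules out all edges outside \<open>dsubsets d M\<close>.\<close>
  have "{e. f e} = {e \<in> dsubsets d M. f e}" if "f \<in> set_pmf ?P" for f
    using that set_Pi_pmf_subset[OF finite_dsubsets] by fastforce
  then have "map_pmf (\<lambda>f. Hypergraph {1..M} {e. f e}) ?P
      = map_pmf (\<lambda>f. Hypergraph {1..M} {e \<in> dsubsets d M. f e}) ?P"
    by (intro map_pmf_cong) auto
  also have "\<dots> = map_pmf (Hypergraph {1..M}) (map_pmf (\<lambda>f. {e \<in> dsubsets d M. f e}) ?P)"
    by (simp add: pmf.map_comp o_def)
  also have "\<dots> = map_pmf (Hypergraph {1..M}) (pmf_of_set (Pow (dsubsets d M)))"
    by (simp add: pmf_of_set_Pow_conv_bernoulli)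
  finally show ?thesis
    by (simp add: uniform_hypergraph_def dsubsets_def)
qed

text \<open>Placing the possible edges of both hypergraphs in one disjoint sum turns the independent
  pair into a single uniform random subset, the setting of
  \<open>prob_private_equalities\<close>.\<close>

definition edge_pmf :: "nat \<Rightarrow> nat \<Rightarrow> nat \<Rightarrow> (nat set + nat set) set pmf" where
  "edge_pmf d n m = pmf_of_set (Pow (dsubsets d n <+> dsubsets d m))"

definition hypergraph_pair ::
    "nat \<Rightarrow> nat \<Rightarrow> (nat set + nat set) set \<Rightarrow> nat hypergraph \<times> nat hypergraph" where
  "hypergraph_pair n m S = (Hypergraph {1..n} (Inl -` S), Hypergraph {1..m} (Inr -` S))"

lemma pair_uniform_hypergraph:
  "pair_pmf (uniform_hypergraph d n) (uniform_hypergraph d m)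
     = map_pmf (hypergraph_pair n m) (edge_pmf d n m)"
proof -
  let ?E = "dsubsets d n" and ?F = "dsubsets d m"
  let ?h = "\<lambda>S :: (nat set + nat set) set. (Inl -` S, Inr -` S)"
  have "bij_betw ?h (Pow (?E <+> ?F)) (Pow ?E \<times> Pow ?F)"
  proof (rule bij_betw_byWitness[where f' = "\<lambda>(G, H). G <+> H"])
    show "\<forall>S\<in>Pow (?E <+> ?F). (case ?h S of (G, H) \<Rightarrow> G <+> H) = S"
    proof
      fix S :: "(nat set + nat set) set"
      have "Inl -` S <+> Inr -` S = S"
      proof (intro set_eqI)
        fix x :: "nat set + nat set"
        show "x \<in> Inl -` S <+> Inr -` S \<longleftrightarrow> x \<in> S" by (cases x) auto
      qed
      then show "(case ?h S of (G, H) \<Rightarrow> G <+> H) = S" by simp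
    qed
  qed auto
  then have "map_pmf ?h (edge_pmf d n m) = pmf_of_set (Pow ?E \<times> Pow ?F)"
    unfolding edge_pmf_def by (intro map_pmf_of_set_bij_betw) (auto simp: finite_Plus)
  also have "\<dots> = pair_pmf (pmf_of_set (Pow ?E)) (pmf_of_set (Pow ?F))"
    by (rule pair_pmf_of_set[symmetric]) auto
  finally have "pair_pmf (uniform_hypergraph d n) (uniform_hypergraph d m)
     = map_pmf (\<lambda>(G, H). (Hypergraph {1..n} G, Hypergraph {1..m} H)) (map_pmf ?h (edge_pmf d n m))"
    by (simp add: uniform_hypergraph_eq map_pair)
  then show ?thesis
    by (simp add: pmf.map_comp o_def hypergraph_pair_def[abs_def])
qed

definition matches ::
    "nat \<Rightarrow> nat \<Rightarrow> (nat \<Rightarrow> nat) \<Rightarrow> (nat \<Rightarrow> nat) \<Rightarrow> (nat set + nat set) set \<Rightarrow> bool" where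
  "matches d k I J S \<longleftrightarrow> (\<forall>e\<in>dsubsets d k. Inl (I ` e) \<in> S \<longleftrightarrow> Inr (J ` e) \<in> S)"

lemma induced_subgraph_eq_iff:
  "induced_subgraph d (fst (hypergraph_pair n m S)) k I
     = induced_subgraph d (snd (hypergraph_pair n m S)) k J \<longleftrightarrow> matches d k I J S"
  by (auto simp: induced_subgraph_def hypergraph_pair_def matches_def dsubsets_def)

text \<open>The \<open>Inl\<close> coordinates are private to their equations: they are distinct
  because \<open>I\<close> is injective, and the other sides are all \<open>Inr\<close>.\<close>

lemma prob_matches:
  assumes I: "inj_on I {1..k}" "I ` {1..k} \<subseteq> {1..n}"
    and J: "inj_on J {1..k}" "J ` {1..k} \<subseteq> {1..m}"
  shows "measure_pmf.prob (edge_pmf d n m) {S. matches d k I J S} = (1/2) ^ (k choose d)"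
proof -
  have "inj_on (\<lambda>e. Inl (I ` e) :: nat set + nat set) (dsubsets d k)"
    using inj_on_image_Pow[OF I(1)] by (auto simp: inj_on_def dsubsets_def)
  moreover have "Inl (I ` e) \<in> dsubsets d n <+> dsubsets d m" "Inr (J ` e) \<in> dsubsets d n <+> dsubsets d m"
    if "e \<in> dsubsets d k" for e
    using image_in_dsubsets[OF that I] image_in_dsubsets[OF that J] by auto
  ultimately show ?thesis
    unfolding edge_pmf_def matches_def card_dsubsets[symmetric]
    by (intro prob_private_equalities) (auto simp: finite_Plus)
qed

section \<open>Tuples with one vertex in each block\<close>

text \<open>Disjointness lets a point reveal its index: f i = g j with f i in \<open>A i\<close> and
  g j in \<open>A j\<close> forces i = j.\<close>

lemma transversal_image_eq:
  assumes disj: "disjoint_family_on A K"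
    and f: "\<And>i. i \<in> K \<Longrightarrow> f i \<in> A i" and g: "\<And>i. i \<in> K \<Longrightarrow> g i \<in> A i"
    and e: "e \<subseteq> K" "e' \<subseteq> K" and eq: "f ` e = g ` e'"
  shows "e = e'" "\<And>i. i \<in> e \<Longrightarrow> f i = g i"
proof -
  have same: "i = j" if "i \<in> K" "j \<in> K" "f i = g j" for i j
    using disj f[of i] g[of j] that unfolding disjoint_family_on_def by auto
  have 1: "i \<in> e' \<and> f i = g i" if i: "i \<in> e" for i
  proof -
    obtain j where "j \<in> e'" "f i = g j" using eq i by blast
    then show ?thesis using same[of i j] e i by auto
  qed
  have 2: "i \<in> e" if i: "i \<in> e'" for i
  proof -
    obtain j where "j \<in> e" "f j = g i" using eq i by (metis imageE imageI)
    then show ?thesis using same[of j i] e i by auto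
  qed
  show "e = e'" using 1 2 by auto
  show "\<And>i. i \<in> e \<Longrightarrow> f i = g i" using 1 by auto
qed

text \<open>Choosing the \<open>i\<close>-th vertices of the two tuples in prescribed blocks \<open>A i\<close>, \<open>B i\<close> loses only a
  factor \<open>k ^ O(k)\<close> in the first moment. In return, two choices \<open>s\<close>, \<open>t\<close> can only impose the same
  equation on the edges through a set of indices on which they agree: the longer cycles that arise
  for general pairs of partial bijections do not occur.\<close>

locale vertex_blocks =
  fixes k n m :: nat and A B :: "nat \<Rightarrow> nat set"
  assumes disj_A: "disjoint_family_on A {1..k}" and disj_B: "disjoint_family_on B {1..k}"
    and A_sub: "\<And>i. i \<in> {1..k} \<Longrightarrow> A i \<subseteq> {1..n}"
    and B_sub: "\<And>i. i \<in> {1..k} \<Longrightarrow> B i \<subseteq> {1..m}"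
begin

definition choices :: "(nat \<Rightarrow> nat \<times> nat) set" where
  "choices = (\<Pi>\<^sub>E i\<in>{1..k}. A i \<times> B i)"

definition hit :: "nat \<Rightarrow> (nat \<Rightarrow> nat \<times> nat) \<Rightarrow> (nat set + nat set) set set" where
  "hit d t = {S. matches d k (fst \<circ> t) (snd \<circ> t) S}"

lemma choices_mem:
  assumes "t \<in> choices" "i \<in> {1..k}"
  shows "(fst \<circ> t) i \<in> A i" "(snd \<circ> t) i \<in> B i"
  using PiE_mem[OF assms[unfolded choices_def]] by auto

lemma choices_inj:
  assumes "t \<in> choices"
  shows "inj_on (fst \<circ> t) {1..k}" "inj_on (snd \<circ> t) {1..k}"
proof -
  show "inj_on (fst \<circ> t) {1..k}"
    using disj_A choices_mem(1)[OF assms] unfolding inj_on_def disjoint_family_on_def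
    by (metis disjoint_iff)
  show "inj_on (snd \<circ> t) {1..k}"
    using disj_B choices_mem(2)[OF assms] unfolding inj_on_def disjoint_family_on_def
    by (metis disjoint_iff)
qed

lemma choices_image:
  assumes "t \<in> choices"
  shows "(fst \<circ> t) ` {1..k} \<subseteq> {1..n}" "(snd \<circ> t) ` {1..k} \<subseteq> {1..m}"
  using choices_mem[OF assms] A_sub B_sub by blast+

lemma choices_dsubsets:
  assumes "t \<in> choices" "e \<in> dsubsets d k"
  shows "(fst \<circ> t) ` e \<in> dsubsets d n" "(snd \<circ> t) ` e \<in> dsubsets d m"
  using assms by (intro image_in_dsubsets[of e d k] choices_inj choices_image; simp)+

lemma fst_image_eq:
  assumes "s \<in> choices" "t \<in> choices" "e \<in> dsubsets d k" "e' \<in> dsubsets d k"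
    and "(fst \<circ> s) ` e = (fst \<circ> t) ` e'"
  shows "e = e'" "\<And>i. i \<in> e \<Longrightarrow> fst (s i) = fst (t i)"
proof -
  have sub: "e \<subseteq> {1..k}" "e' \<subseteq> {1..k}" using assms(3,4) by (simp_all add: dsubsets_def)
  note * = transversal_image_eq[OF disj_A choices_mem(1)[OF assms(1)] choices_mem(1)[OF assms(2)] sub assms(5)]
  show "e = e'" by (rule *(1))
  show "\<And>i. i \<in> e \<Longrightarrow> fst (s i) = fst (t i)" using *(2) by simp
qed

lemma snd_image_eq:
  assumes "s \<in> choices" "t \<in> choices" "e \<in> dsubsets d k" "e' \<in> dsubsets d k"
    and "(snd \<circ> s) ` e = (snd \<circ> t) ` e'"
  shows "e = e'" "\<And>i. i \<in> e \<Longrightarrow> snd (s i) = snd (t i)"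
proof -
  have sub: "e \<subseteq> {1..k}" "e' \<subseteq> {1..k}" using assms(3,4) by (simp_all add: dsubsets_def)
  note * = transversal_image_eq[OF disj_B choices_mem(2)[OF assms(1)] choices_mem(2)[OF assms(2)] sub assms(5)]
  show "e = e'" by (rule *(1))
  show "\<And>i. i \<in> e \<Longrightarrow> snd (s i) = snd (t i)" using *(2) by simp
qed

lemma prob_hit:
  assumes "t \<in> choices"
  shows "measure_pmf.prob (edge_pmf d n m) (hit d t) = (1/2) ^ (k choose d)"
  unfolding hit_def using choices_inj[OF assms] choices_image[OF assms]
  by (intro prob_matches)

text \<open>The equations that \<open>s\<close> and \<open>t\<close> attach to a d-subset coincide
  exactly when the subset lies in the agreement set. Counting those once leaves a system with
  private coordinates, so each remaining equation costs a factor 1/2.\<close>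

lemma prob_hit_hit:
  assumes s: "s \<in> choices" and t: "t \<in> choices"
  shows "measure_pmf.prob (edge_pmf d n m) (hit d s \<inter> hit d t)
    = (1/2) ^ (2 * (k choose d)) * 2 ^ (card {i\<in>{1..k}. s i = t i} choose d)"
proof -
  define F where "F = {i\<in>{1..k}. s i = t i}"
  define D where "D = dsubsets d k"
  define DF where "DF = {e. e \<subseteq> F \<and> card e = d}"
  \<comment> \<open>The label \<open>False\<close> marks equations of \<open>s\<close>,
    \<open>True\<close> those of \<open>t\<close>; repeated equations are kept under
    \<open>False\<close> only.\<close>
  define C where "C = {False} \<times> D \<union> {True} \<times> (D - DF)"
  define r where "r = (\<lambda>b. if b then t else s)"
  define moved where "moved e \<longleftrightarrow> (fst \<circ> s) ` e \<noteq> (fst \<circ> t) ` e" for e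
  define L where "L = (\<lambda>(b, e). Inl ((fst \<circ> r b) ` e) :: nat set + nat set)"
  define R where "R = (\<lambda>(b, e). Inr ((snd \<circ> r b) ` e) :: nat set + nat set)"
  \<comment> \<open>An index set \<open>e\<close> is constrained once by \<open>s\<close> and once by \<open>t\<close>. If the two edges of the first
    hypergraph differ, they are private to these two constraints; otherwise those of the second
    hypergraph are, unless the two constraints coincide.\<close>
  define u where "u c = (if moved (snd c) then L c else R c)" for c
  define v where "v c = (if moved (snd c) then R c else L c)" for c
  have r: "r b \<in> choices" for b using s t by (simp add: r_def)
  have CD: "e \<in> D" if "(b, e) \<in> C" for b e using that by (auto simp: C_def)
  have DF_sub: "DF \<subseteq> D" by (auto simp: DF_def D_def F_def dsubsets_def)
  have agree: "e \<in> DF" if "e \<in> D" "\<And>i. i \<in> e \<Longrightarrow> s i = t i" for e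
    using that by (auto simp: DF_def D_def F_def dsubsets_def)
  have L_eq: "e = e'" "b \<noteq> b' \<Longrightarrow> i \<in> e \<Longrightarrow> fst (s i) = fst (t i)"
    if "L (b, e) = L (b', e')" "e \<in> D" "e' \<in> D" for b b' e e' i
  proof -
    have eq: "(fst \<circ> r b) ` e = (fst \<circ> r b') ` e'" using that(1) by (simp add: L_def)
    note * = fst_image_eq[OF r r that(2,3)[unfolded D_def] eq]
    show "e = e'" by (rule *(1))
    show "fst (s i) = fst (t i)" if "b \<noteq> b'" "i \<in> e"
      using *(2)[OF that(2)] that(1) by (auto simp: r_def split: if_splits)
  qed
  have R_eq: "e = e'" "b \<noteq> b' \<Longrightarrow> i \<in> e \<Longrightarrow> snd (s i) = snd (t i)"
    if "R (b, e) = R (b', e')" "e \<in> D" "e' \<in> D" for b b' e e' i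
  proof -
    have eq: "(snd \<circ> r b) ` e = (snd \<circ> r b') ` e'" using that(1) by (simp add: R_def)
    note * = snd_image_eq[OF r r that(2,3)[unfolded D_def] eq]
    show "e = e'" by (rule *(1))
    show "snd (s i) = snd (t i)" if "b \<noteq> b'" "i \<in> e"
      using *(2)[OF that(2)] that(1) by (auto simp: r_def split: if_splits)
  qed
  have LR: "L c \<noteq> R c'" for c c' by (auto simp: L_def R_def split: prod.splits)
  have moved_iff: "moved e \<longleftrightarrow> (\<exists>i\<in>e. fst (s i) \<noteq> fst (t i))" if "e \<in> D" for e
    using L_eq(2)[of False e True e] that by (auto simp: moved_def L_def r_def image_iff intro!: image_cong)
  have prob: "measure_pmf.prob (edge_pmf d n m) {S. \<forall>c\<in>C. u c \<in> S \<longleftrightarrow> v c \<in> S} = (1/2) ^ card C"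
    unfolding edge_pmf_def
  proof (rule prob_private_equalities)
    have LR_mem: "L c \<in> dsubsets d n <+> dsubsets d m" "R c \<in> dsubsets d n <+> dsubsets d m" if "c \<in> C" for c
      using choices_dsubsets[OF r CD[unfolded D_def], of "fst c" "snd c" "fst c"] that
      by (auto simp: L_def R_def split: prod.splits)
    then show "u ` C \<subseteq> dsubsets d n <+> dsubsets d m" "v ` C \<subseteq> dsubsets d n <+> dsubsets d m"
      by (auto simp: u_def v_def)
    show "inj_on u C"
    proof (rule inj_onI, clarify)
      fix b e b' e'
      assume c: "(b, e) \<in> C" and c': "(b', e') \<in> C" and eq: "u (b, e) = u (b', e')"
      note D = CD[OF c] CD[OF c']
      have e: "e = e'"
        using eq L_eq(1)[OF _ D] R_eq(1)[OF _ D] LR LR[symmetric] by (auto simp: u_def split: if_splits)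
      moreover have "b = b'"
      proof (rule ccontr)
        assume b: "b \<noteq> b'"
        then have nDF: "e \<notin> DF" using c c' e by (auto simp: C_def)
        show False
        proof (cases "moved e")
          case True
          then have "L (b, e) = L (b', e')" using eq e by (simp add: u_def)
          then show False using L_eq(2)[OF _ D b] True moved_iff[OF D(1)] by blast
        next
          case False
          then have "R (b, e) = R (b', e')" using eq e by (simp add: u_def)
          then have "s i = t i" if "i \<in> e" for i
            using R_eq(2)[OF _ D b that] False moved_iff[OF D(1)] that by (metis prod_eqI)
          then show False using agree D(1) nDF by blast
        qed
      qed
      ultimately show "b = b' \<and> e = e'" by simp
    qed
    \<comment> \<open>A common value would come from the same index set on both sides. As
      \<open>moved\<close> depends on the index set alone, \<open>u\<close> and \<open>v\<close>
      then pick opposite sides, one \<open>Inl\<close> and one \<open>Inr\<close>.\<close>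
    show "u ` C \<inter> v ` C = {}"
    proof (rule ccontr)
      assume "u ` C \<inter> v ` C \<noteq> {}"
      then obtain b e b' e' where c: "(b, e) \<in> C" "(b', e') \<in> C" and eq: "u (b, e) = v (b', e')"
        by auto
      note D = CD[OF c(1)] CD[OF c(2)]
      have "e = e'"
        using eq L_eq(1)[OF _ D] R_eq(1)[OF _ D] LR LR[symmetric] by (auto simp: u_def v_def split: if_splits)
      then show False using eq LR LR[symmetric] by (auto simp: u_def v_def split: if_splits)
    qed
  qed (simp add: finite_Plus)
  have "hit d s \<inter> hit d t = {S. \<forall>c\<in>C. u c \<in> S \<longleftrightarrow> v c \<in> S}"
  proof -
    have uv: "(u c \<in> S \<longleftrightarrow> v c \<in> S) \<longleftrightarrow> (L c \<in> S \<longleftrightarrow> R c \<in> S)" for c S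
      by (auto simp: u_def v_def)
    have same: "L (True, e) = L (False, e)" "R (True, e) = R (False, e)" if "e \<in> DF" for e
      using that by (auto simp: L_def R_def r_def DF_def F_def image_iff intro!: image_cong)
    have "S \<in> hit d s \<inter> hit d t \<longleftrightarrow> (\<forall>b. \<forall>e\<in>D. L (b, e) \<in> S \<longleftrightarrow> R (b, e) \<in> S)" for S
      by (auto simp: hit_def matches_def L_def R_def r_def D_def)
    also have "\<dots> S \<longleftrightarrow> (\<forall>c\<in>C. L c \<in> S \<longleftrightarrow> R c \<in> S)" for S
    proof
      assume *: "\<forall>c\<in>C. L c \<in> S \<longleftrightarrow> R c \<in> S"
      show "\<forall>b. \<forall>e\<in>D. L (b, e) \<in> S \<longleftrightarrow> R (b, e) \<in> S"
      proof (intro allI ballI)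
        fix b e assume e: "e \<in> D"
        have "(False, e) \<in> C" using e by (simp add: C_def)
        moreover have "(True, e) \<in> C \<or> e \<in> DF" using e by (simp add: C_def)
        ultimately show "L (b, e) \<in> S \<longleftrightarrow> R (b, e) \<in> S"
          using * same[of e] by (cases b) metis+
      qed
    qed (auto simp: C_def)
    finally show ?thesis unfolding uv by blast
  qed
  moreover have "card C = (k choose d) + ((k choose d) - (card F choose d))"
  proof -
    have "finite D" by (simp add: D_def)
    moreover have "card DF = card F choose d"
      unfolding DF_def by (rule n_subsets) (simp add: F_def)
    moreover have "card D = k choose d" by (simp add: D_def)
    ultimately show ?thesis unfolding C_def
      using DF_sub by (subst card_Un_disjoint) (auto simp: card_cartesian_product card_Diff_subset finite_subset)
  qed
  moreover have "card F choose d \<le> k choose d"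
  proof (rule binomial_right_mono)
    have "F \<subseteq> {1..k}" by (auto simp: F_def)
    then show "card F \<le> k" using card_mono[of "{1..k}" F] by simp
  qed
  ultimately show ?thesis
    using prob unfolding F_def[symmetric]
    by (simp add: power_add power_diff power_mult power2_eq_square power_one_over field_simps)
qed

end

text \<open>Absorption gives (j choose d) / j = ((j - 1) choose (d - 1)) / d, which is nondecreasing
  in j. The inequality is cross-multiplied so that zero needs no exception.\<close>

lemma binomial_le_linear:
  assumes "1 \<le> d" "f \<le> k"
  shows "k * (f choose d) \<le> f * (k choose d)"
proof (cases "f = 0")
  case False
  have abs: "d * (j choose d) = j * ((j - 1) choose (d - 1))" if "1 \<le> j" for j
    using binomial_absorption[of "d - 1" "j"] times_binomial_minus1_eq[of d j] assms that by simp
  have "d * (k * (f choose d)) = k * (f * ((f - 1) choose (d - 1)))"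
    using abs[of f] False by (simp add: algebra_simps)
  also have "\<dots> \<le> k * (f * ((k - 1) choose (d - 1)))"
    using assms by (intro mult_left_mono binomial_right_mono) auto
  also have "\<dots> = d * (f * (k choose d))"
    using abs[of k] False assms by (simp add: algebra_simps)
  finally show ?thesis using assms by simp
qed (use assms in simp)

section \<open>Second moment bound for choices from blocks\<close>

context vertex_blocks
begin

lemma finite_blocks:
  assumes "i \<in> {1..k}"
  shows "finite (A i)" "finite (B i)"
  using A_sub[OF assms] B_sub[OF assms] by (auto intro: finite_subset)

text \<open>The second moment is a sum of \<open>2 ^ (f choose d)\<close>, \<open>f\<close> the number of agreements; bounding this
  by \<open>r ^ f\<close> with \<open>r = 2 powr ((k choose d) / k)\<close> makes the sum factorise over the indices.\<close>

lemma sum_power_agreements: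
  fixes r :: real
  assumes s: "s \<in> choices" and N: "\<And>i. i \<in> {1..k} \<Longrightarrow> card (A i) * card (B i) = N"
  shows "(\<Sum>t\<in>choices. r ^ card {i\<in>{1..k}. s i = t i}) = (real N - 1 + r) ^ k"
proof -
  have fin: "finite (A i \<times> B i)" if "i \<in> {1..k}" for i
    using finite_blocks[OF that] by simp
  have "(\<Sum>t\<in>choices. r ^ card {i\<in>{1..k}. s i = t i})
      = (\<Sum>t\<in>choices. \<Prod>i\<in>{1..k}. if s i = t i then r else 1)"
    by (simp add: prod.If_cases Int_def)
  also have "\<dots> = (\<Prod>i\<in>{1..k}. \<Sum>x\<in>A i \<times> B i. if s i = x then r else 1)"
    unfolding choices_def using fin by (intro prod_sum_PiE[symmetric]) auto
  also have "\<dots> = (\<Prod>i\<in>{1..k}. real N - 1 + r)"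
  proof (rule prod.cong)
    fix i assume i: "i \<in> {1..k}"
    have si: "s i \<in> A i \<times> B i"
      using s i unfolding choices_def by (rule PiE_mem)
    have "(\<Sum>x\<in>A i \<times> B i. if s i = x then r else 1)
        = (\<Sum>x\<in>A i \<times> B i. 1 + (if s i = x then r - 1 else 0))"
      by (intro sum.cong) auto
    also have "\<dots> = real (card (A i \<times> B i)) + (r - 1)"
      using fin[OF i] si by (simp add: sum.distrib)
    finally show "(\<Sum>x\<in>A i \<times> B i. if s i = x then r else 1) = real N - 1 + r"
      using N[OF i] by (simp add: card_cartesian_product)
  qed simp
  finally show ?thesis by simp
qed

text \<open>Both moments factorise over the k indices, so their quotient is y ^ k with y = N / (N -
  1 + r). Bernoulli's inequality and 1 - y = (r - 1) / (N - 1 + r) <= r / N make the bound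
  linear.\<close>

lemma prob_some_hit:
  assumes d: "1 \<le> d" and k: "1 \<le> k" and N0: "N > 0"
    and N: "\<And>i. i \<in> {1..k} \<Longrightarrow> card (A i) * card (B i) = N"
  shows "measure_pmf.prob (edge_pmf d n m) (\<Union>t\<in>choices. hit d t)
    \<ge> 1 - real k * 2 powr (real (k choose d) / real k) / real N"
proof -
  let ?P = "measure_pmf.prob (edge_pmf d n m)"
  define p where "p = ?P (\<Union>t\<in>choices. hit d t)"
  define q :: real where "q = (1/2) ^ (k choose d)"
  define r where "r = (2::real) powr (real (k choose d) / real k)"
  have r: "r \<ge> 1" unfolding r_def by (rule ge_one_powr_ge_zero) auto
  have fin: "finite choices"
    unfolding choices_def using finite_blocks by (intro finite_PiE) auto
  have "card choices = (\<Prod>i\<in>{1..k}. card (A i \<times> B i))"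
    unfolding choices_def by (rule card_PiE) simp
  also have "\<dots> = (\<Prod>i\<in>{1..k}. N)"
    using N by (intro prod.cong) (simp_all add: card_cartesian_product)
  finally have card: "card choices = N ^ k" by simp
  have pw: "2 ^ (f choose d) \<le> r ^ f" if "f \<le> k" for f
  proof -
    have "real k * real (f choose d) \<le> real f * real (k choose d)"
      using binomial_le_linear[OF d that] by (metis of_nat_le_iff of_nat_mult)
    then have "real (f choose d) \<le> real (k choose d) / real k * real f"
      using k by (simp add: field_simps)
    then have "(2::real) powr real (f choose d) \<le> 2 powr (real (k choose d) / real k * real f)"
      by (intro powr_mono) auto
    moreover have "r ^ f = r powr real f"
      using r by (simp add: powr_realpow)
    ultimately show ?thesis
      by (simp add: r_def powr_powr powr_realpow)
  qed
  have "(\<Sum>s\<in>choices. \<Sum>t\<in>choices. ?P (hit d s \<inter> hit d t))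
      \<le> (\<Sum>s\<in>choices. \<Sum>t\<in>choices. q\<^sup>2 * r ^ card {i\<in>{1..k}. s i = t i})"
  proof (intro sum_mono)
    fix s t assume st: "s \<in> choices" "t \<in> choices"
    have "card {i\<in>{1..k}. s i = t i} \<le> k"
      using card_mono[of "{1..k}" "{i\<in>{1..k}. s i = t i}"]
      by (simp add: Collect_mono_iff subset_iff)
    then show "?P (hit d s \<inter> hit d t) \<le> q\<^sup>2 * r ^ card {i\<in>{1..k}. s i = t i}"
      unfolding prob_hit_hit[OF st] q_def
      by (simp only: power_mult[symmetric] mult.commute[of _ 2]) (intro mult_left_mono pw; simp)
  qed
  also have "\<dots> = (\<Sum>s\<in>choices. q\<^sup>2 * (real N - 1 + r) ^ k)"
    by (intro sum.cong refl) (simp only: sum_distrib_left[symmetric] sum_power_agreements[OF _ N])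
  finally have sm: "(\<Sum>s\<in>choices. \<Sum>t\<in>choices. ?P (hit d s \<inter> hit d t))
      \<le> real N ^ k * (q\<^sup>2 * (real N - 1 + r) ^ k)"
    by (simp add: card)
  have "(\<Sum>t\<in>choices. ?P (hit d t)) = real N ^ k * q"
    by (simp add: prob_hit card q_def)
  then have "(real N ^ k * q)\<^sup>2 \<le> p * (real N ^ k * (q\<^sup>2 * (real N - 1 + r) ^ k))"
    using second_moment[OF fin, of "edge_pmf d n m" "hit d"] sm
    by (simp add: p_def) (meson mult_left_mono measure_nonneg order_trans)
  moreover have pos: "real N ^ k * q\<^sup>2 > 0" using N0 by (simp add: q_def)
  ultimately have "real N ^ k * q\<^sup>2 * (real N ^ k) \<le> real N ^ k * q\<^sup>2 * (p * (real N - 1 + r) ^ k)"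
    by (simp add: power_mult_distrib power2_eq_square mult_ac)
  then have le: "real N ^ k \<le> p * (real N - 1 + r) ^ k"
    using mult_le_cancel_left_pos[OF pos] by blast
  define y where "y = real N / (real N - 1 + r)"
  have den: "real N - 1 + r > 0" using N0 r by simp
  have "1 + real k * (y - 1) \<le> (1 + (y - 1)) ^ k"
    using den by (intro Bernoulli_inequality) (simp add: y_def)
  also have "\<dots> \<le> p"
    using le den by (simp add: y_def power_divide divide_le_eq)
  finally have "1 + real k * (y - 1) \<le> p" .
  moreover have "1 - y \<le> r / real N"
  proof -
    have "real N * (r - 1) \<le> r * (real N - 1 + r)"
    proof -
      have "r * 1 \<le> r * r" using r by (intro mult_left_mono) auto
      then have "r \<le> real N + r * r" by linarith
      then show ?thesis by (simp add: algebra_simps)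
    qed
    then show ?thesis using den N0 by (simp add: y_def field_simps)
  qed
  then have "real k * (1 - y) \<le> real k * (r / real N)"
    by (intro mult_left_mono) auto
  ultimately show ?thesis
    by (simp add: p_def r_def algebra_simps)
qed

end

section \<open>Union bound, and lower bounds from concrete blocks\<close>

lemma prob_common_size_le:
  "measure_pmf.prob (edge_pmf d n m)
     {S. k \<in> common_sizes d (fst (hypergraph_pair n m S)) (snd (hypergraph_pair n m S))}
   \<le> (real n * real m) ^ k / 2 ^ (k choose d)"
proof -
  let ?K = "{1..k}"
  define T where "T = {(I, J). I \<in> ?K \<rightarrow>\<^sub>E {1..n} \<and> inj_on I ?K \<and> J \<in> ?K \<rightarrow>\<^sub>E {1..m} \<and> inj_on J ?K}"
  have T_sub: "T \<subseteq> (?K \<rightarrow>\<^sub>E {1..n}) \<times> (?K \<rightarrow>\<^sub>E {1..m})" by (auto simp: T_def)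
  have fin: "finite ((?K \<rightarrow>\<^sub>E {1..n}) \<times> (?K \<rightarrow>\<^sub>E {1..m}))"
    by (intro finite_cartesian_product finite_PiE) auto
  have "card T \<le> n ^ k * m ^ k"
    using card_mono[OF fin T_sub] by (simp add: card_cartesian_product card_PiE)
  then have card: "real (card T) \<le> (real n * real m) ^ k"
    by (metis of_nat_le_iff of_nat_mult of_nat_power power_mult_distrib)
  have "{S. k \<in> common_sizes d (fst (hypergraph_pair n m S)) (snd (hypergraph_pair n m S))}
      \<subseteq> (\<Union>t\<in>T. {S. matches d k (fst t) (snd t) S})"
  proof
    fix S assume "S \<in> {S. k \<in> common_sizes d (fst (hypergraph_pair n m S)) (snd (hypergraph_pair n m S))}"
    then obtain I J where "vertex_tuple (fst (hypergraph_pair n m S)) k I"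
      "vertex_tuple (snd (hypergraph_pair n m S)) k J" and M: "matches d k I J S"
      unfolding common_sizes_def mem_Collect_eq induced_subgraph_eq_iff by blast
    then have I: "inj_on I ?K" "I ` ?K \<subseteq> {1..n}" and J: "inj_on J ?K" "J ` ?K \<subseteq> {1..m}"
      by (simp_all add: vertex_tuple_def hypergraph_pair_def)
    \<comment> \<open>Tuples matter on \<open>{1..k}\<close> only; restricting them makes the index
      set of the union bound finite.\<close>
    have "(restrict I ?K, restrict J ?K) \<in> T"
      using I J by (simp add: T_def inj_on_restrict_eq image_subset_iff del: atLeastAtMost_iff One_nat_def)
    moreover have "matches d k (restrict I ?K) (restrict J ?K) S"
    proof -
      have "restrict f ?K ` e = f ` e" if "e \<in> dsubsets d k" for e and f :: "nat \<Rightarrow> nat"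
        using that by (intro image_cong) (auto simp: dsubsets_def)
      with M show ?thesis by (simp add: matches_def)
    qed
    ultimately show "S \<in> (\<Union>t\<in>T. {S. matches d k (fst t) (snd t) S})"
      by (intro UN_I[of "(restrict I ?K, restrict J ?K)"]) simp_all
  qed
  then have "measure_pmf.prob (edge_pmf d n m)
     {S. k \<in> common_sizes d (fst (hypergraph_pair n m S)) (snd (hypergraph_pair n m S))}
     \<le> measure_pmf.prob (edge_pmf d n m) (\<Union>t\<in>T. {S. matches d k (fst t) (snd t) S})"
    by (intro measure_pmf.finite_measure_mono) auto
  also have "\<dots> \<le> (\<Sum>t\<in>T. measure_pmf.prob (edge_pmf d n m) {S. matches d k (fst t) (snd t) S})"
    using finite_subset[OF T_sub fin] by (intro measure_pmf.finite_measure_subadditive_finite) auto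
  also have "\<dots> = (\<Sum>t\<in>T. (1/2) ^ (k choose d))"
    by (intro sum.cong prob_matches) (auto simp: T_def PiE_iff)
  also have "\<dots> \<le> (real n * real m) ^ k / 2 ^ (k choose d)"
    using card by (simp add: power_one_over divide_right_mono field_simps)
  finally show ?thesis .
qed

text \<open>For i in \<open>{1..k}\<close>, this is the residue class of i modulo k within
  \<open>{1..k * (n div k)}\<close>. Leftover vertices are dropped so that all blocks have the same
  size, as \<open>prob_some_hit\<close> requires.\<close>

definition block :: "nat \<Rightarrow> nat \<Rightarrow> nat \<Rightarrow> nat set" where
  "block k n i = (\<lambda>j. i + k * j) ` {..<n div k}"

lemma card_block: "k > 0 \<Longrightarrow> card (block k n i) = n div k"
  unfolding block_def by (subst card_image) (auto simp: inj_on_def)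

lemma block_subset:
  assumes "i \<in> {1..k}"
  shows "block k n i \<subseteq> {1..n}"
proof
  fix v assume "v \<in> block k n i"
  then obtain j where v: "v = i + k * j" and j: "j < n div k" by (auto simp: block_def)
  have "v \<le> k * Suc j" using assms v by simp
  also have "\<dots> \<le> k * (n div k)" using j by (intro mult_left_mono) auto
  also have "\<dots> \<le> n" by simp
  finally show "v \<in> {1..n}" using assms v by simp
qed

lemma disjoint_block: "disjoint_family_on (block k n) {1..k}"
  unfolding disjoint_family_on_def
proof (intro ballI impI)
  fix i i' assume i: "i \<in> {1..k}" "i' \<in> {1..k}" "i \<noteq> i'"
  have "i + k * j \<noteq> i' + k * j'" for j j'
  proof
    assume eq: "i + k * j = i' + k * j'"
    \<comment> \<open>The shift by 1 moves the indices to \<open>{0..<k}\<close>, where reduction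
      modulo k is injective.\<close>
    have "((i - 1) + k * j) mod k = ((i' - 1) + k * j') mod k"
      using eq i by (metis Nat.add_diff_assoc2 atLeastAtMost_iff)
    moreover have "i - 1 < k" "i' - 1 < k" using i by auto
    ultimately show False using i by auto
  qed
  then show "block k n i \<inter> block k n i' = {}" by (auto simp: block_def)
qed

lemma div_ge_half:
  assumes "1 \<le> k" "k \<le> n"
  shows "real n / (2 * real k) \<le> real (n div k)"
proof -
  have "n \<le> k * (n div k) + k"
    using assms mult_div_mod_eq[of k n] mod_less_divisor[of k n] by linarith
  also have "\<dots> \<le> 2 * k * (n div k)"
    using assms div_le_mono[of k n k] by (cases "n div k") auto
  finally have "real n \<le> real (2 * k * (n div k))" by (rule of_nat_mono)
  then show ?thesis using assms by (simp add: field_simps)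
qed

text \<open>Rounding costs at most a factor 2 per block size, so each index has at least n m / (2
  k)^2 pairs. With the factor k of \<open>prob_some_hit\<close> this yields
  \<open>4 * real k ^ 3\<close>.\<close>

lemma prob_common_size_ge:
  assumes d: "1 \<le> d" and k: "1 \<le> k" "k \<le> m" "k \<le> n"
  shows "measure_pmf.prob (edge_pmf d n m)
      {S. k \<in> common_sizes d (fst (hypergraph_pair n m S)) (snd (hypergraph_pair n m S))}
    \<ge> 1 - 4 * real k ^ 3 * 2 powr (real (k choose d) / real k) / (real n * real m)"
proof -
  interpret vertex_blocks k n m "block k n" "block k m"
    by unfold_locales (simp_all only: disjoint_block block_subset)
  have "real n / (2 * real k) * (real m / (2 * real k)) \<le> real (n div k) * real (m div k)"
    using k by (intro mult_mono div_ge_half) auto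
  then have N: "real n * real m / (4 * real k ^ 2) \<le> real (n div k * (m div k))"
    by (simp add: power2_eq_square)
  have N0: "n div k * (m div k) > 0" using k by (simp add: div_greater_zero_iff)
  define w where "w = real k * 2 powr (real (k choose d) / real k)"
  have "w / real (n div k * (m div k)) \<le> w / (real n * real m / (4 * real k ^ 2))"
    using N k by (intro divide_left_mono) (auto simp: w_def div_greater_zero_iff)
  also have "\<dots> = 4 * real k ^ 3 * 2 powr (real (k choose d) / real k) / (real n * real m)"
    by (simp add: w_def power2_eq_square power3_eq_cube)
  finally have "1 - 4 * real k ^ 3 * 2 powr (real (k choose d) / real k) / (real n * real m)
      \<le> 1 - w / real (n div k * (m div k))" by simp
  also have "\<dots> \<le> measure_pmf.prob (edge_pmf d n m) (\<Union>t\<in>choices. hit d t)"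
    unfolding w_def by (rule prob_some_hit[OF d k(1) N0]) (use k in \<open>simp add: card_block\<close>)
  also have "\<dots> \<le> measure_pmf.prob (edge_pmf d n m)
      {S. k \<in> common_sizes d (fst (hypergraph_pair n m S)) (snd (hypergraph_pair n m S))}"
  proof (rule measure_pmf.finite_measure_mono)
    show "(\<Union>t\<in>choices. hit d t)
        \<subseteq> {S. k \<in> common_sizes d (fst (hypergraph_pair n m S)) (snd (hypergraph_pair n m S))}"
    proof
      fix S assume "S \<in> (\<Union>t\<in>choices. hit d t)"
      then obtain t where t: "t \<in> choices" and "matches d k (fst \<circ> t) (snd \<circ> t) S"
        by (auto simp: hit_def)
      moreover have "vertex_tuple (fst (hypergraph_pair n m S)) k (fst \<circ> t)"
        "vertex_tuple (snd (hypergraph_pair n m S)) k (snd \<circ> t)"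
        using choices_inj[OF t] choices_image[OF t]
        by (simp_all only: vertex_tuple_def hypergraph_pair_def fst_conv snd_conv hypergraph.sel simp_thms)
      ultimately show "S \<in> {S. k \<in> common_sizes d (fst (hypergraph_pair n m S)) (snd (hypergraph_pair n m S))}"
        unfolding common_sizes_def mem_Collect_eq induced_subgraph_eq_iff by blast
    qed
  qed simp
  finally show ?thesis .
qed

text \<open>Singleton blocks \<open>{i}\<close> force the second tuple to agree with
  \<open>id\<close> on \<open>{1..k}\<close>. Only the first hypergraph then contributes choices, at
  least n / (2 k) per index.\<close>

lemma prob_initial_segment_ge:
  assumes d: "1 \<le> d" and k: "1 \<le> k" "k \<le> m" "k \<le> n"
  shows "measure_pmf.prob (edge_pmf d n m)
      {S. \<exists>I. vertex_tuple (fst (hypergraph_pair n m S)) k I \<and>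
              induced_subgraph d (fst (hypergraph_pair n m S)) k I
                = induced_subgraph d (snd (hypergraph_pair n m S)) k id}
    \<ge> 1 - 2 * real k ^ 2 * 2 powr (real (k choose d) / real k) / real n"
proof -
  interpret vertex_blocks k n m "block k n" "\<lambda>i. {i}"
    using k by unfold_locales
      (simp_all only: disjoint_block block_subset, auto simp: disjoint_family_on_def)
  have N: "real n / (2 * real k) \<le> real (n div k)"
    using k by (intro div_ge_half)
  have N0: "n div k > 0" using k by (simp add: div_greater_zero_iff)
  define w where "w = real k * 2 powr (real (k choose d) / real k)"
  have "w / real (n div k) \<le> w / (real n / (2 * real k))"
    using N k by (intro divide_left_mono) (auto simp: w_def div_greater_zero_iff)
  also have "\<dots> = 2 * real k ^ 2 * 2 powr (real (k choose d) / real k) / real n"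
    by (simp add: w_def power2_eq_square)
  finally have "1 - 2 * real k ^ 2 * 2 powr (real (k choose d) / real k) / real n
      \<le> 1 - w / real (n div k)" by simp
  also have "\<dots> \<le> measure_pmf.prob (edge_pmf d n m) (\<Union>t\<in>choices. hit d t)"
    unfolding w_def by (rule prob_some_hit[OF d k(1) N0]) (use k in \<open>simp add: card_block\<close>)
  also have "\<dots> \<le> measure_pmf.prob (edge_pmf d n m)
      {S. \<exists>I. vertex_tuple (fst (hypergraph_pair n m S)) k I \<and>
              induced_subgraph d (fst (hypergraph_pair n m S)) k I
                = induced_subgraph d (snd (hypergraph_pair n m S)) k id}" (is "_ \<le> measure_pmf.prob _ ?R")
  proof (rule measure_pmf.finite_measure_mono)
    show "(\<Union>t\<in>choices. hit d t) \<subseteq> ?R"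
    proof
      fix S assume "S \<in> (\<Union>t\<in>choices. hit d t)"
      then obtain t where t: "t \<in> choices" and m: "matches d k (fst \<circ> t) (snd \<circ> t) S"
        by (auto simp: hit_def)
      have "(snd \<circ> t) ` e = id ` e" if "e \<in> dsubsets d k" for e
        using choices_mem(2)[OF t] that by (intro image_cong) (auto simp: dsubsets_def)
      then have "matches d k (fst \<circ> t) id S" using m by (simp add: matches_def del: id_apply image_id)
      moreover have "vertex_tuple (fst (hypergraph_pair n m S)) k (fst \<circ> t)"
        using choices_inj[OF t] choices_image[OF t]
        by (simp only: vertex_tuple_def hypergraph_pair_def fst_conv hypergraph.sel simp_thms)
      ultimately show "S \<in> ?R"
        unfolding mem_Collect_eq induced_subgraph_eq_iff by blast
    qed
  qed simp
  finally show ?thesis .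
qed

section \<open>The critical size\<close>

lemma fact_mult_binomial_div:
  assumes "1 \<le> d" "1 \<le> k"
  shows "fact d * (real (k choose d) / real k) = (\<Prod>i\<in>{1..d-1}. real k - real i)"
proof -
  have "real (k choose d) = (\<Prod>i=0..<d. real k - real i) / fact d"
    by (simp add: binomial_gbinomial gbinomial_prod_rev)
  also have "(\<Prod>i=0..<d. real k - real i) = real k * (\<Prod>i\<in>{1..d-1}. real k - real i)"
  proof -
    have "{0..<d} = insert 0 {1..d-1}" using assms by auto
    then show ?thesis by simp
  qed
  finally show ?thesis using assms by simp
qed

text \<open>Pairing the factors \<open>i\<close> and \<open>d - i\<close>, whose mean is \<open>k - d / 2\<close>, is the source of the shift
  \<open>d / 2\<close> in the critical size.\<close>

lemma prod_shift_squared: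
  "(\<Prod>i\<in>{1..d-1}. real k - real i)\<^sup>2
     = (\<Prod>i\<in>{1..d-1}. (real k - real d / 2)\<^sup>2 - (real d / 2 - real i)\<^sup>2)"
proof -
  have "(\<Prod>i\<in>{1..d-1}. real k - real i) = (\<Prod>i\<in>{1..d-1}. real k - real (d - i))"
    by (rule prod.reindex_bij_witness[where i = "\<lambda>i. d - i" and j = "\<lambda>i. d - i"]) auto
  then have "(\<Prod>i\<in>{1..d-1}. real k - real i)\<^sup>2
      = (\<Prod>i\<in>{1..d-1}. (real k - real i) * (real k - real (d - i)))"
    by (simp add: power2_eq_square prod.distrib)
  also have "\<dots> = (\<Prod>i\<in>{1..d-1}. (real k - real d / 2)\<^sup>2 - (real d / 2 - real i)\<^sup>2)"
    by (intro prod.cong) (auto simp: of_nat_diff power2_eq_square field_simps)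
  finally show ?thesis .
qed

context
  fixes d k :: nat
  assumes dk: "d \<le> k"
begin

lemma prod_shift_nonneg: "0 \<le> (\<Prod>i\<in>{1..d-1}. real k - real i)"
proof (rule prod_nonneg)
  fix i assume "i \<in> {1..d-1}"
  then have "i \<le> k" using dk by auto
  then show "0 \<le> real k - real i" by simp
qed

text \<open>AM-GM on each pair of factors; \<open>d \<le> k\<close> keeps the paired products
  nonnegative, so that they may be multiplied.\<close>

lemma prod_shift_le: "(\<Prod>i\<in>{1..d-1}. real k - real i) \<le> (real k - real d / 2) ^ (d - 1)"
proof (rule power2_le_imp_le)
  have "(\<Prod>i\<in>{1..d-1}. real k - real i)\<^sup>2 \<le> (\<Prod>i\<in>{1..d-1}. (real k - real d / 2)\<^sup>2)"
    unfolding prod_shift_squared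
  proof (intro prod_mono conjI)
    fix i assume "i \<in> {1..d-1}"
    then have "real i \<le> real d" by auto
    then have "\<bar>real d / 2 - real i\<bar> \<le> real k - real d / 2" using dk by (simp add: abs_le_iff)
    then show "0 \<le> (real k - real d / 2)\<^sup>2 - (real d / 2 - real i)\<^sup>2"
      by (simp add: abs_le_square_iff[symmetric])
  qed simp
  then show "(\<Prod>i\<in>{1..d-1}. real k - real i)\<^sup>2 \<le> ((real k - real d / 2) ^ (d - 1))\<^sup>2"
    by (simp add: power_mult[symmetric] mult.commute)
qed (use dk in simp)

text \<open>Pairing loses at most (d / 2)^2 in each factor of the squared product, and the bound on
  \<open>w\<close> absorbs this loss.\<close>

lemma prod_shift_ge:
  assumes w: "0 \<le> w" "w\<^sup>2 \<le> (real k - real d / 2)\<^sup>2 - (real d / 2)\<^sup>2"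
  shows "w ^ (d - 1) \<le> (\<Prod>i\<in>{1..d-1}. real k - real i)"
proof (rule power2_le_imp_le)
  have "(\<Prod>i\<in>{1..d-1}. w\<^sup>2) \<le> (\<Prod>i\<in>{1..d-1}. real k - real i)\<^sup>2"
    unfolding prod_shift_squared
  proof (intro prod_mono conjI)
    fix i assume "i \<in> {1..d-1}"
    then have "real i \<le> real d" by auto
    then have "\<bar>real d / 2 - real i\<bar> \<le> \<bar>real d / 2\<bar>" by linarith
    then have "(real d / 2 - real i)\<^sup>2 \<le> (real d / 2)\<^sup>2" by (simp only: abs_le_square_iff)
    then show "w\<^sup>2 \<le> (real k - real d / 2)\<^sup>2 - (real d / 2 - real i)\<^sup>2"
      using w(2) by linarith
  qed simp
  then show "(w ^ (d - 1))\<^sup>2 \<le> (\<Prod>i\<in>{1..d-1}. real k - real i)\<^sup>2"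
    by (simp add: power_mult[symmetric] mult.commute)
qed (rule prod_shift_nonneg)

end

text \<open>The quantity (k choose d) / k is 1 / d times the mean degree of the complete
  d-hypergraph on k vertices. Of the d - 1 factors X - e, one is kept and the others are raised to
  X: a gain linear in e is enough.\<close>

lemma mean_degree_le:
  fixes X e :: real
  assumes d: "2 \<le> d" and k: "1 \<le> k" and e: "0 \<le> e" "e \<le> X" and kX: "real k - real d / 2 \<le> X - e"
  shows "real (k choose d) / real k \<le> (X ^ (d - 1) - e * X ^ (d - 2)) / fact d"
proof -
  have Suc: "d - 1 = Suc (d - 2)" using d by simp
  have "fact d * (real (k choose d) / real k) \<le> X ^ (d - 1) - e * X ^ (d - 2)"
  proof (cases "d \<le> k")
    case True
    have "fact d * (real (k choose d) / real k) \<le> (real k - real d / 2) ^ (d - 1)"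
      using fact_mult_binomial_div[of d k] prod_shift_le[of d k] d k True by simp
    also have "\<dots> \<le> (X - e) ^ (d - 1)"
      using kX True by (intro power_mono) auto
    also have "\<dots> = (X - e) * (X - e) ^ (d - 2)"
      by (simp only: Suc power_Suc)
    also have "\<dots> \<le> (X - e) * X ^ (d - 2)"
      using e by (intro mult_left_mono power_mono) auto
    finally show ?thesis by (simp only: Suc power_Suc left_diff_distrib)
  next
    \<comment> \<open>For k < d the binomial coefficient vanishes, and e <= X makes the right-hand
      side nonnegative.\<close>
    case False
    then show ?thesis using e by (simp only: Suc power_Suc) (simp add: binomial_eq_0 mult_right_mono)
  qed
  then show ?thesis by (simp add: field_simps)
qed

text \<open>Half of the excess e pays for the loss (d / 2)^2 in \<open>prod_shift_ge\<close>, since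
  (X + e)^2 exceeds (X + e / 2)^2 by at least X * e; the other half remains as gain.\<close>

lemma mean_degree_ge:
  fixes X e :: real
  assumes d: "2 \<le> d" and dk: "d \<le> k" and e: "0 \<le> e" "0 \<le> X" and kX: "X + e \<le> real k - real d / 2"
    and Xe: "(real d)\<^sup>2 \<le> X * e"
  shows "(X ^ (d - 1) + e / 2 * X ^ (d - 2)) / fact d \<le> real (k choose d) / real k"
proof -
  have Suc: "d - 1 = Suc (d - 2)" using d by simp
  have "X ^ (d - 1) + e / 2 * X ^ (d - 2) = (X + e / 2) * X ^ (d - 2)"
    by (simp only: Suc power_Suc distrib_right)
  also have "\<dots> \<le> (X + e / 2) * (X + e / 2) ^ (d - 2)"
    using e by (intro mult_left_mono power_mono) auto
  also have "\<dots> = (X + e / 2) ^ (d - 1)"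
    by (simp only: Suc power_Suc)
  also have "\<dots> \<le> (\<Prod>i\<in>{1..d-1}. real k - real i)"
  proof (rule prod_shift_ge)
    have "(X + e)\<^sup>2 \<le> (real k - real d / 2)\<^sup>2"
      using kX e by (intro power_mono) auto
    moreover have "(X + e / 2)\<^sup>2 + (real d / 2)\<^sup>2 \<le> (X + e)\<^sup>2"
    proof -
      have "(real d)\<^sup>2 \<le> 4 * (X * e) + 3 * e\<^sup>2"
        using Xe zero_le_power2[of e] zero_le_power2[of "real d"] by linarith
      then show ?thesis by (simp add: power2_eq_square field_simps)
    qed
    ultimately show "(X + e / 2)\<^sup>2 \<le> (real k - real d / 2)\<^sup>2 - (real d / 2)\<^sup>2" by linarith
  qed (use d dk e in auto)
  also have "\<dots> = fact d * (real (k choose d) / real k)"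
    using fact_mult_binomial_div[of d k] d dk by simp
  finally show ?thesis by (simp add: field_simps)
qed

lemma tail_tendsto_0:
  fixes c e :: real
  assumes "c > 0" "e > 0"
  shows "((\<lambda>L. 4 * (c * L) ^ 3 * 2 powr (- (L powr e) / c)) \<longlongrightarrow> 0) at_top"
  using assms by real_asymp

definition critical :: "nat \<Rightarrow> real \<Rightarrow> real" where
  "critical d l = (fact d * l) powr (1 / (real d - 1))"

text \<open>Up to constants, \<open>gain\<close> bounds from below the change of \<open>(k choose d) / k\<close> when \<open>k\<close> moves from the
  critical size by \<open>L powr (- 1 / d)\<close>; it beats every multiple of \<open>log 2 L\<close>.\<close>

definition gain :: "nat \<Rightarrow> real \<Rightarrow> real" where
  "gain d L = L powr (1 / (real d - 1) - 1 / real d)"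

text \<open>One error term for both sides of the critical size. The base 3 d! L bounds k by
  \<open>size_le\<close>; the exponents gain / d! below and gain / (2 d!) above are both weakened to
  gain / (3 d!), to fit \<open>tail_tendsto_0\<close> with a single constant.\<close>

definition tail :: "nat \<Rightarrow> real \<Rightarrow> real" where
  "tail d L = 4 * (3 * fact d * L) ^ 3 * 2 powr (- gain d L / (3 * fact d))"

lemma gain_exponent_pos: "3 \<le> d \<Longrightarrow> 1 / (real d - 1) - 1 / real d > 0"
  by (simp add: field_simps)

lemma tail_tendsto:
  assumes "3 \<le> d"
  shows "(tail d \<longlongrightarrow> 0) at_top"
  unfolding tail_def gain_def
  using tail_tendsto_0[of "3 * fact d" "1 / (real d - 1) - 1 / real d"] gain_exponent_pos[OF assms]
  by simp

lemma gain_tendsto: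
  assumes "3 \<le> d"
  shows "filterlim (gain d) at_top at_top"
  unfolding gain_def using gain_exponent_pos[OF assms] by real_asymp

section \<open>Mean degrees at distance \<open>L powr (- 1 / real d)\<close> from the critical
  size\<close>

context
  fixes d :: nat and L l :: real
  assumes d3: "3 \<le> d" and L1: "1 \<le> L" and Ll: "L \<le> l"
begin

lemma critical_pow: "critical d l ^ (d - 1) = fact d * l"
proof -
  have "critical d l ^ (d - 1) = critical d l powr real (d - 1)"
    using L1 Ll by (subst powr_realpow) (auto simp: critical_def)
  then show ?thesis
    using L1 Ll d3 by (simp add: critical_def powr_powr of_nat_diff)
qed

lemma fact_mult_ge: "L \<le> fact d * l"
proof -
  have "1 * L \<le> fact d * l" using L1 Ll by (intro mult_mono fact_ge_1) auto
  then show ?thesis by simp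
qed

lemma critical_ge: "L powr (1 / (real d - 1)) \<le> critical d l"
  unfolding critical_def using fact_mult_ge L1 d3 by (intro powr_mono2) auto

lemma critical_ge_1: "1 \<le> critical d l"
proof -
  have "1 \<le> L powr (1 / (real d - 1))" using L1 d3 by (intro ge_one_powr_ge_zero) auto
  then show ?thesis using critical_ge by linarith
qed

lemma critical_le: "critical d l \<le> fact d * l"
proof -
  have "critical d l \<le> (fact d * l) powr 1"
    unfolding critical_def using fact_mult_ge L1 d3 by (intro powr_mono) auto
  then show ?thesis using fact_mult_ge L1 by simp
qed

lemma eps_bounds: "0 \<le> L powr (- 1 / real d)" "L powr (- 1 / real d) \<le> 1"
proof -
  have "L powr (- 1 / real d) \<le> L powr 0" using L1 by (intro powr_mono) auto
  then show "L powr (- 1 / real d) \<le> 1" using L1 by simp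
qed simp

lemma gain_le: "gain d L \<le> critical d l * L powr (- 1 / real d)"
proof -
  have "gain d L = L powr (1 / (real d - 1)) * L powr (- 1 / real d)"
    by (simp add: gain_def powr_add[symmetric])
  also have "\<dots> \<le> critical d l * L powr (- 1 / real d)"
    using critical_ge by (intro mult_right_mono) auto
  finally show ?thesis .
qed

text \<open>Here d >= 3 enters: the power d - 2 keeps at least one factor
  \<open>critical d l\<close>.\<close>

lemma gain_le_pow: "gain d L \<le> L powr (- 1 / real d) * critical d l ^ (d - 2)"
proof -
  have "critical d l ^ 1 \<le> critical d l ^ (d - 2)"
    using critical_ge_1 d3 by (intro power_increasing) auto
  then have "critical d l * L powr (- 1 / real d) \<le> critical d l ^ (d - 2) * L powr (- 1 / real d)"
    by (intro mult_right_mono) auto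
  then show ?thesis using gain_le by (simp add: mult.commute)
qed

lemma mean_degree_below_critical:
  assumes "1 \<le> k" "real k \<le> critical d l + real d / 2 - L powr (- 1 / real d)"
  shows "real (k choose d) / real k \<le> l - gain d L / fact d"
proof -
  have "real (k choose d) / real k
      \<le> (critical d l ^ (d - 1) - L powr (- 1 / real d) * critical d l ^ (d - 2)) / fact d"
    using d3 eps_bounds critical_ge_1 assms by (intro mean_degree_le) auto
  also have "\<dots> \<le> (fact d * l - gain d L) / fact d"
    unfolding critical_pow using gain_le_pow by (intro divide_right_mono) auto
  finally show ?thesis by (simp add: diff_divide_distrib)
qed

lemma mean_degree_above_critical:
  assumes K: "real K > critical d l + real d / 2 + L powr (- 1 / real d)"
    and gain: "(real d)\<^sup>2 \<le> gain d L"
  shows "l + gain d L / (2 * fact d) \<le> real (K choose d) / real K"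
proof -
  \<comment> \<open>The bound on the gain serves twice: it yields d <= K here, and the condition d^2
    <= X * e of \<open>mean_degree_ge\<close> below.\<close>
  have "real d \<le> (real d)\<^sup>2" using d3 by (simp add: power2_eq_square)
  also have "\<dots> \<le> critical d l * L powr (- 1 / real d)" using gain gain_le by linarith
  also have "\<dots> \<le> critical d l * 1"
    using eps_bounds critical_ge_1 by (intro mult_left_mono) auto
  finally have dK: "d \<le> K" using K eps_bounds by linarith
  have "l + gain d L / (2 * fact d) = (fact d * l + gain d L / 2) / fact d"
    by (simp add: field_simps)
  also have "\<dots> \<le> (critical d l ^ (d - 1) + L powr (- 1 / real d) / 2 * critical d l ^ (d - 2)) / fact d"
    unfolding critical_pow using gain_le_pow by (intro divide_right_mono) auto
  also have "\<dots> \<le> real (K choose d) / real K"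
    using d3 dK eps_bounds critical_ge_1 K gain gain_le by (intro mean_degree_ge) auto
  finally show ?thesis .
qed

text \<open>A crude bound suffices: k enters the error only as k^3, and any power of L is beaten by
  the exponential of the gain.\<close>

lemma size_le:
  assumes "l \<le> 2 * L" "real k \<le> critical d l + real d / 2"
  shows "real k \<le> 3 * fact d * L"
proof -
  have "critical d l \<le> fact d * (2 * L)"
    using critical_le assms(1) by (meson fact_ge_zero mult_left_mono order_trans)
  moreover have "real d \<le> fact d * L"
  proof -
    have "real d \<le> fact d"
      using fact_ge_self[of d] by (metis of_nat_fact of_nat_le_iff)
    then have "real d * 1 \<le> fact d * L"
      using L1 by (intro mult_mono) auto
    then show ?thesis by simp
  qed
  ultimately show ?thesis using assms(2) by linarith
qed

lemma tail_ge_below_critical: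
  assumes k: "1 \<le> k" "real k \<le> critical d l + real d / 2 - L powr (- 1 / real d)"
    and l: "l \<le> 2 * L"
  shows "4 * real k ^ 3 * 2 powr (real (k choose d) / real k) / 2 powr l \<le> tail d L"
proof -
  have "4 * real k ^ 3 * 2 powr (real (k choose d) / real k) / 2 powr l
      = 4 * real k ^ 3 * 2 powr (real (k choose d) / real k - l)"
    by (simp add: powr_diff)
  also have "\<dots> \<le> 4 * (3 * fact d * L) ^ 3 * 2 powr (- gain d L / (3 * fact d))"
  proof (intro mult_mono power_mono powr_mono)
    show "real k \<le> 3 * fact d * L"
    proof (rule size_le[OF l])
      show "real k \<le> critical d l + real d / 2" using k(2) eps_bounds(1) by linarith
    qed
    have "gain d L / (3 * fact d) \<le> gain d L / fact d"
      by (intro divide_left_mono) (auto simp: gain_def)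
    then show "real (k choose d) / real k - l \<le> - gain d L / (3 * fact d)"
      using mean_degree_below_critical[OF k] by simp
  qed (use L1 in auto)
  finally show ?thesis by (simp add: tail_def)
qed

lemma tail_ge_powr: "2 powr (- gain d L / (2 * fact d)) \<le> tail d L"
proof -
  have "1 * 1 \<le> 3 * fact d * L" using L1 fact_ge_1[of d, where ?'a = real] by (intro mult_mono) linarith+
  then have "1 \<le> 3 * fact d * L" by simp
  then have "1 \<le> (3 * fact d * L) ^ 3" by (rule one_le_power)
  then have "1 \<le> 4 * (3 * fact d * L) ^ 3" by linarith
  moreover have "2 powr (- gain d L / (2 * fact d)) \<le> 2 powr (- gain d L / (3 * fact d))"
    by (intro powr_mono) (auto simp: gain_def divide_left_mono)
  ultimately have "1 * 2 powr (- gain d L / (2 * fact d))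
      \<le> 4 * (3 * fact d * L) ^ 3 * 2 powr (- gain d L / (3 * fact d))"
    by (intro mult_mono powr_ge_zero) linarith+
  then show ?thesis by (simp add: tail_def)
qed

end

section \<open>Probabilities just above and just below the critical size\<close>

context
  fixes d n m :: nat
  assumes d3: "3 \<le> d" and m: "1 \<le> m" "m \<le> n" and L1: "1 \<le> log 2 (real n)"
begin

lemma log_product_bounds:
  "log 2 (real n) \<le> log 2 (real n * real m)" "log 2 (real n * real m) \<le> 2 * log 2 (real n)"
proof -
  have "log 2 (real n * real m) = log 2 (real n) + log 2 (real m)"
    using m by (simp add: log_mult)
  moreover have "0 \<le> log 2 (real m)" "log 2 (real m) \<le> log 2 (real n)"
    using m by auto
  ultimately show "log 2 (real n) \<le> log 2 (real n * real m)" "log 2 (real n * real m) \<le> 2 * log 2 (real n)"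
    by auto
qed

lemma prob_above_critical:
  assumes K: "real K > critical d (log 2 (real n * real m)) + real d / 2 + log 2 (real n) powr (- 1 / real d)"
    and gain: "(real d)\<^sup>2 \<le> gain d (log 2 (real n))"
  shows "measure_pmf.prob (edge_pmf d n m)
      {S. K \<in> common_sizes d (fst (hypergraph_pair n m S)) (snd (hypergraph_pair n m S))}
    \<le> tail d (log 2 (real n))"
proof -
  let ?L = "log 2 (real n)" and ?l = "log 2 (real n * real m)"
  note mean = mean_degree_above_critical[OF d3 L1 log_product_bounds(1) K gain]
  have K1: "1 \<le> K"
    using K critical_ge_1[OF d3 L1 log_product_bounds(1)] eps_bounds(1)[OF d3 L1 log_product_bounds(1)] by linarith
  \<comment> \<open>The exponent of the union bound is -K times the excess of the mean degree over
    \<open>?l\<close>; of this factor K only K >= 1 is used.\<close>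
  have "1 * (gain d ?L / (2 * fact d)) \<le> real K * (real (K choose d) / real K - ?l)"
    using mean K1 by (intro mult_mono) (auto simp: gain_def)
  then have le: "?l * real K - real (K choose d) \<le> - gain d ?L / (2 * fact d)"
    using K1 by (simp add: algebra_simps)
  have nm: "real n * real m = 2 powr ?l" using m by simp
  have "(real n * real m) ^ K / 2 ^ (K choose d) = 2 powr (?l * real K - real (K choose d))"
    unfolding powr_diff powr_powr[symmetric] nm[symmetric] using m by (simp add: powr_realpow)
  also have "\<dots> \<le> 2 powr (- gain d ?L / (2 * fact d))"
    using le by (intro powr_mono) auto
  also have "\<dots> \<le> tail d ?L"
    using d3 L1 by (rule tail_ge_powr[OF _ _ order_refl])
  finally show ?thesis using prob_common_size_le[of d n m K] by linarith
qed

lemma prob_below_critical: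
  assumes k: "1 \<le> k" "real k \<le> critical d (log 2 (real n * real m)) + real d / 2 - log 2 (real n) powr (- 1 / real d)"
    and km: "k \<le> m"
  shows "measure_pmf.prob (edge_pmf d n m)
      {S. k \<in> common_sizes d (fst (hypergraph_pair n m S)) (snd (hypergraph_pair n m S))}
    \<ge> 1 - tail d (log 2 (real n))"
proof -
  have nm: "2 powr log 2 (real n * real m) = real n * real m" using m by simp
  have kn: "k \<le> n" and d1: "1 \<le> d" using km m d3 by linarith+
  show ?thesis
    using prob_common_size_ge[OF d1 k(1) km kn]
      tail_ge_below_critical[OF d3 L1 log_product_bounds(1) k log_product_bounds(2)]
    unfolding nm by linarith
qed

lemma prob_initial_segment:
  assumes k: "1 \<le> k" "real k \<le> critical d (log 2 (real n)) + real d / 2 - log 2 (real n) powr (- 1 / real d)"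
    and km: "k \<le> m"
  shows "measure_pmf.prob (edge_pmf d n m)
      {S. \<exists>I. vertex_tuple (fst (hypergraph_pair n m S)) k I \<and>
              induced_subgraph d (fst (hypergraph_pair n m S)) k I
                = induced_subgraph d (snd (hypergraph_pair n m S)) k id}
    \<ge> 1 - tail d (log 2 (real n))"
proof -
  have "0 < real n" using m by linarith
  then have n: "2 powr log 2 (real n) = real n" by (intro powr_log_cancel) auto
  have kn: "k \<le> n" and d1: "1 \<le> d" using km m d3 by linarith+
  have l: "log 2 (real n) \<le> 2 * log 2 (real n)" using L1 by linarith
  \<comment> \<open>Loosening 2 k^2 to 4 k^3 allows \<open>tail_ge_below_critical\<close> to be used
    with l = L.\<close>
  have "2 * real k ^ 2 * 2 powr (real (k choose d) / real k) / real n
      \<le> 4 * real k ^ 3 * 2 powr (real (k choose d) / real k) / real n"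
  proof (intro divide_right_mono mult_right_mono)
    have "real k ^ 2 \<le> real k ^ 3" using k(1) by (intro power_increasing) auto
    then show "2 * real k ^ 2 \<le> 4 * real k ^ 3" using zero_le_power[of "real k" 3] by linarith
  qed auto
  also have "\<dots> \<le> tail d (log 2 (real n))"
    using tail_ge_below_critical[OF d3 L1 order_refl k l] unfolding n .
  finally show ?thesis
    using prob_initial_segment_ge[OF d1 k(1) km kn] by linarith
qed

end

section \<open>Concentration of the largest common size\<close>

text \<open>Prefixes of matching tuples match. Hence the absence of one size K excludes all larger
  sizes.\<close>

lemma common_sizes_downward:
  assumes "k \<in> common_sizes d G H" "j \<le> k"
  shows "j \<in> common_sizes d G H"
proof -
  obtain I J where I: "vertex_tuple G k I" and J: "vertex_tuple H k J"
    and eq: "induced_subgraph d G k I = induced_subgraph d H k J"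
    using assms(1) by (auto simp: common_sizes_def)
  have sub: "{1..j} \<subseteq> {1..k}" using assms(2) by auto
  have "vertex_tuple G j I" "vertex_tuple H j J"
    using I J sub unfolding vertex_tuple_def by (meson image_mono inj_on_subset order_trans)+
  moreover have "induced_subgraph d G j I = induced_subgraph d H j J"
    using eq sub unfolding induced_subgraph_def hypergraph.inject by blast
  ultimately show ?thesis by (auto simp: common_sizes_def)
qed

lemma largest_common_size_bounds:
  assumes "d_hypergraph d G" "k \<in> common_sizes d G H" "K \<notin> common_sizes d G H"
  shows "k \<le> largest_common_size d G H" "largest_common_size d G H < K"
proof -
  have fin: "finite (common_sizes d G H)" using assms(1) by (rule common_sizes_finite)
  then show "k \<le> largest_common_size d G H"
    unfolding largest_common_size_def using assms(2) by (rule Max_ge)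
  have "largest_common_size d G H \<in> common_sizes d G H"
    unfolding largest_common_size_def using fin assms(2) by (intro Max_in) auto
  then show "largest_common_size d G H < K"
    using assms(3) common_sizes_downward[of "largest_common_size d G H" d G H K] by (meson not_le)
qed

lemma edge_pmf_support:
  assumes "S \<in> set_pmf (edge_pmf d n m)"
  shows "d_hypergraph d (fst (hypergraph_pair n m S))" "Inr -` S \<subseteq> dsubsets d m"
proof -
  have "set_pmf (edge_pmf d n m) = Pow (dsubsets d n <+> dsubsets d m)"
    unfolding edge_pmf_def by (rule set_pmf_of_set) (auto simp: finite_Plus)
  then have "S \<subseteq> dsubsets d n <+> dsubsets d m"
    using assms by blast
  then show "d_hypergraph d (fst (hypergraph_pair n m S))" "Inr -` S \<subseteq> dsubsets d m"
    by (auto simp: d_hypergraph_def hypergraph_pair_def dsubsets_def)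
qed

lemma prob_pair_uniform_hypergraph:
  "measure_pmf.prob (pair_pmf (uniform_hypergraph d n) (uniform_hypergraph d m)) {\<omega>. P \<omega>}
     = measure_pmf.prob (edge_pmf d n m) {S. P (hypergraph_pair n m S)}"
  unfolding pair_uniform_hypergraph measure_map_pmf by (simp add: vimage_def)

lemma prob_largest_between:
  fixes t :: real
  assumes k: "measure_pmf.prob (edge_pmf d n m)
      {S. k \<in> common_sizes d (fst (hypergraph_pair n m S)) (snd (hypergraph_pair n m S))} \<ge> 1 - t"
    and K: "measure_pmf.prob (edge_pmf d n m)
      {S. K \<in> common_sizes d (fst (hypergraph_pair n m S)) (snd (hypergraph_pair n m S))} \<le> t"
    and P: "\<And>l. k \<le> l \<Longrightarrow> l < K \<Longrightarrow> P l"
  shows "measure_pmf.prob (pair_pmf (uniform_hypergraph d n) (uniform_hypergraph d m))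
      {\<omega>. case \<omega> of (\<Gamma>1, \<Gamma>2) \<Rightarrow> P (largest_common_size d \<Gamma>1 \<Gamma>2)} \<ge> 1 - 2 * t"
proof -
  let ?M = "edge_pmf d n m"
  let ?C = "\<lambda>j. {S. j \<in> common_sizes d (fst (hypergraph_pair n m S)) (snd (hypergraph_pair n m S))}"
  let ?G = "{S. P (largest_common_size d (fst (hypergraph_pair n m S)) (snd (hypergraph_pair n m S)))}"
  \<comment> \<open>On the support the first component is a d-hypergraph, so the set of sizes is
    finite and its \<open>Max\<close> is attained.\<close>
  have "measure_pmf.prob ?M (?C k) = measure_pmf.prob ?M (?C k \<inter> set_pmf ?M)"
    by (rule measure_Int_set_pmf[symmetric])
  also have "\<dots> \<le> measure_pmf.prob ?M (?C K \<union> ?G)"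
  proof (intro measure_pmf.finite_measure_mono subsetI)
    fix S assume S: "S \<in> ?C k \<inter> set_pmf ?M"
    show "S \<in> ?C K \<union> ?G"
    proof (cases "S \<in> ?C K")
      case False
      then show ?thesis
        using largest_common_size_bounds[OF edge_pmf_support(1)] S P by blast
    qed simp
  qed simp
  also have "\<dots> \<le> measure_pmf.prob ?M (?C K) + measure_pmf.prob ?M ?G"
    by (rule measure_Un_le) auto
  finally show ?thesis
    using k K unfolding prob_pair_uniform_hypergraph by (simp add: case_prod_unfold)
qed

text \<open>Since 2 w < 1, the two floors differ by at most 1, so no integer lies strictly between
  them. The bound 1 <= c - w keeps \<open>nat\<close> from truncating.\<close>

lemma floor_two_point:
  fixes c w :: real
  assumes "1 \<le> c - w" "w < 1/2" "nat \<lfloor>c - w\<rfloor> \<le> l" "l < nat (\<lfloor>c + w\<rfloor> + 1)"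
  shows "int l \<in> {\<lfloor>c - w\<rfloor>, \<lfloor>c + w\<rfloor>}"
proof -
  have "\<lfloor>c + w\<rfloor> \<le> \<lfloor>c - w + 1\<rfloor>" using assms(2) by (intro floor_mono) simp
  then have "\<lfloor>c + w\<rfloor> \<le> \<lfloor>c - w\<rfloor> + 1" by simp
  then show ?thesis using assms(3,4) by auto
qed

section \<open>Limits as the number of vertices grows\<close>

lemma whp_of_eventually_ge:
  assumes "\<forall>\<^sub>F n in sequentially. 1 - t n \<le> measure_pmf.prob (p n) {\<omega>. P n \<omega>}"
    and "t \<longlonglongrightarrow> 0"
  shows "whp p P"
  unfolding whp_def
proof (rule tendsto_sandwich[OF assms(1) _ _ tendsto_const])
  show "(\<lambda>n. 1 - t n) \<longlonglongrightarrow> 1" using tendsto_diff[OF tendsto_const[of 1] assms(2)] by simp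
qed simp

lemma log2_tendsto: "filterlim (\<lambda>n. log 2 (real n)) at_top sequentially"
  by real_asymp

lemma tail_log2_tendsto:
  assumes "3 \<le> d"
  shows "(\<lambda>n. c * tail d (log 2 (real n))) \<longlonglongrightarrow> 0"
  using tendsto_mult_right_zero[OF filterlim_compose[OF tail_tendsto[OF assms] log2_tendsto]] .

lemma eventually_large:
  assumes "3 \<le> d"
  shows "\<forall>\<^sub>F n in sequentially. 1 \<le> n \<and> 1 \<le> log 2 (real n) \<and> (real d)\<^sup>2 \<le> gain d (log 2 (real n))
      \<and> log 2 (real n) powr (- 1 / real d) < 1/2"
proof (intro eventually_conj)
  show "\<forall>\<^sub>F n in sequentially. 1 \<le> log 2 (real n)"
    using log2_tendsto by (simp add: filterlim_at_top)
  show "\<forall>\<^sub>F n in sequentially. (real d)\<^sup>2 \<le> gain d (log 2 (real n))"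
    using filterlim_compose[OF gain_tendsto[OF assms] log2_tendsto] by (simp add: filterlim_at_top)
  have "- 1 / real d < 0" using assms by simp
  then have "((\<lambda>n. log 2 (real n) powr (- 1 / real d)) \<longlongrightarrow> 0) sequentially"
    by (intro tendsto_neg_powr log2_tendsto)
  then show "\<forall>\<^sub>F n in sequentially. log 2 (real n) powr (- 1 / real d) < 1/2"
    by (rule order_tendstoD(2)) simp
qed (rule eventually_ge_at_top)

text \<open>Uses (1 + h / L) powr p <= 1 + h / L for 0 <= p <= 1. With h = log 2 m the last quotient
  is the ratio that separates the two regimes.\<close>

lemma critical_add_le:
  assumes d: "3 \<le> d" and L: "0 < L" and h: "0 \<le> h"
  shows "critical d L \<le> critical d (L + h)"
    and "critical d (L + h) \<le> critical d L
          + fact d powr (1 / (real d - 1)) * (h / L powr (1 - 1 / (real d - 1)))"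
proof -
  let ?p = "1 / (real d - 1)"
  have p: "0 \<le> ?p" "?p \<le> 1" using d by simp_all
  have crit: "critical d x = fact d powr ?p * x powr ?p" for x
    by (simp add: critical_def powr_mult)
  show "critical d L \<le> critical d (L + h)"
    unfolding critical_def using L h p by (intro powr_mono2 mult_left_mono) auto
  have "L + h = L * (1 + h / L)" using L by (simp add: field_simps)
  then have "(L + h) powr ?p = L powr ?p * (1 + h / L) powr ?p"
    using L h by (simp only: powr_mult)
  also have "\<dots> \<le> L powr ?p * (1 + h / L) powr 1"
    using L h p by (intro mult_left_mono powr_mono) auto
  also have "\<dots> = L powr ?p + h / (L / L powr ?p)"
    using L h by (simp add: field_simps)
  also have "L / L powr ?p = L powr (1 - ?p)"
    using L by (simp add: powr_diff)
  finally have "fact d powr ?p * (L + h) powr ?p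
      \<le> fact d powr ?p * (L powr ?p + h / L powr (1 - ?p))"
    by (intro mult_left_mono) auto
  then show "critical d (L + h) \<le> critical d L + fact d powr ?p * (h / L powr (1 - ?p))"
    by (simp only: crit distrib_left)
qed

text \<open>In exponential form, 2 powr (c * sqrt L) outgrows b * L. The exponent 1/2 is the least
  value of 1 - 1 / (d - 1) for d >= 3.\<close>

lemma eventually_exp_ge_linear:
  assumes "0 < c" "0 < (b::real)"
  shows "\<forall>\<^sub>F L in at_top. log 2 (b * L) \<le> c * L powr (1/2)"
  using assms by real_asymp

lemma xseq_eq: "xseq d N2 n = critical d (log 2 (real n * real (N2 n))) + real d / 2"
  by (simp add: xseq_def critical_def)

lemma yseq_eq: "yseq d n = critical d (log 2 (real n)) + real d / 2"
  by (simp add: yseq_def critical_def)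

lemma initial_segment_common:
  assumes "k \<le> m" "vertex_tuple (fst (hypergraph_pair n m S)) k I"
    "induced_subgraph d (fst (hypergraph_pair n m S)) k I
       = induced_subgraph d (snd (hypergraph_pair n m S)) k id"
  shows "k \<in> common_sizes d (fst (hypergraph_pair n m S)) (snd (hypergraph_pair n m S))"
proof -
  have "vertex_tuple (snd (hypergraph_pair n m S)) k id"
    using assms(1) by (auto simp: vertex_tuple_def hypergraph_pair_def)
  then show ?thesis using assms(2,3) unfolding common_sizes_def by blast
qed

lemma induced_subgraph_id:
  assumes "Inr -` S \<subseteq> dsubsets d m"
  shows "induced_subgraph d (snd (hypergraph_pair n m S)) m id = snd (hypergraph_pair n m S)"
  using assms by (auto simp: induced_subgraph_def hypergraph_pair_def dsubsets_def)

theorem theorem1p1: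
  fixes d :: nat and N2 :: "nat \<Rightarrow> nat"
    and \<Gamma> :: "nat \<Rightarrow> (nat hypergraph \<times> nat hypergraph) pmf"
  assumes "d \<ge> 3"
    and "\<And>n. n \<ge> 1 \<Longrightarrow> 0 < N2 n"
    and "\<And>n. n \<ge> 1 \<Longrightarrow> N2 n \<le> n"
    and "\<And>n. n \<ge> 1 \<Longrightarrow> \<Gamma> n = pair_pmf (uniform_hypergraph d n) (uniform_hypergraph d (N2 n))"
  shows
    "(liminf (\<lambda>n. ereal (log 2 (real (N2 n)) / log 2 (real n) powr (1 - 1 / (real d - 1)))) > 0
      \<longrightarrow> whp \<Gamma> (\<lambda>n (\<Gamma>1, \<Gamma>2).
            int (largest_common_size d \<Gamma>1 \<Gamma>2)
              \<in> {\<lfloor>xseq d N2 n - log 2 (real n) powr (- 1 / real d)\<rfloor>,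
                  \<lfloor>xseq d N2 n + log 2 (real n) powr (- 1 / real d)\<rfloor>}))
     \<and> ((\<lambda>n. log 2 (real (N2 n))) \<in> o(\<lambda>n. log 2 (real n) powr (1 - 1 / (real d - 1)))
      \<longrightarrow> ((\<forall>\<^sub>F n in sequentially.
              int (N2 n) > \<lfloor>yseq d n - log 2 (real n) powr (- 1 / real d)\<rfloor>)
            \<longrightarrow> (\<exists>\<mu> :: nat \<Rightarrow> real. (\<forall>n\<ge>1. \<mu> n > 0) \<and> \<mu> \<longlonglongrightarrow> 0 \<and>
                  whp \<Gamma> (\<lambda>n (\<Gamma>1, \<Gamma>2).
                    int (largest_common_size d \<Gamma>1 \<Gamma>2)
                      \<in> {\<lfloor>yseq d n - \<mu> n\<rfloor>, \<lfloor>yseq d n + \<mu> n\<rfloor>})))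
        \<and> ((\<forall>\<^sub>F n in sequentially.
              int (N2 n) \<le> \<lfloor>yseq d n - log 2 (real n) powr (- 1 / real d)\<rfloor>)
            \<longrightarrow> whp \<Gamma> (\<lambda>n (\<Gamma>1, \<Gamma>2). is_induced_subgraph d \<Gamma>2 \<Gamma>1)))"
proof (intro conjI impI)
  note d = assms(1)
  let ?L = "\<lambda>n. log 2 (real n)"
  let ?l = "\<lambda>n. log 2 (real n * real (N2 n))"
  let ?e = "\<lambda>n. ?L n powr (- 1 / real d)"
  let ?p = "1 / (real d - 1)"
  let ?C = "\<lambda>n k. {S. k \<in> common_sizes d (fst (hypergraph_pair n (N2 n) S)) (snd (hypergraph_pair n (N2 n) S))}"
  have N2: "1 \<le> N2 n" "N2 n \<le> n" if "1 \<le> n" for n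
    using assms(2,3)[OF that] by simp_all
  {
    assume "liminf (\<lambda>n. ereal (log 2 (real (N2 n)) / ?L n powr (1 - ?p))) > 0"
    then obtain c where c: "0 < c"
      "ereal c < liminf (\<lambda>n. ereal (log 2 (real (N2 n)) / ?L n powr (1 - ?p)))"
      using ereal_dense2 ereal_less(2) by blast
    have ratio: "\<forall>\<^sub>F n in sequentially. c < log 2 (real (N2 n)) / ?L n powr (1 - ?p)"
      using less_LiminfD[OF c(2)] by simp
    have lin: "\<forall>\<^sub>F n in sequentially. log 2 (3 * fact d * ?L n) \<le> c * ?L n powr (1/2)"
      using eventually_compose_filterlim[OF eventually_exp_ge_linear[OF c(1)] log2_tendsto, of "3 * fact d"]
      by simp
    have "\<forall>\<^sub>F n in sequentially. 1 - 2 * tail d (?L n)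
        \<le> measure_pmf.prob (\<Gamma> n) {\<omega>. case \<omega> of (\<Gamma>1, \<Gamma>2) \<Rightarrow>
            int (largest_common_size d \<Gamma>1 \<Gamma>2) \<in> {\<lfloor>xseq d N2 n - ?e n\<rfloor>, \<lfloor>xseq d N2 n + ?e n\<rfloor>}}"
      using eventually_large[OF d] ratio lin
    proof eventually_elim
      case (elim n)
      then have n1: "1 \<le> n" and L1: "1 \<le> ?L n" and g: "(real d)\<^sup>2 \<le> gain d (?L n)" and e: "?e n < 1/2"
        by auto
      note lb = log_product_bounds[OF d N2[OF n1] L1]
      have x1: "1 \<le> xseq d N2 n - ?e n"
        using critical_ge_1[OF d L1 lb(1)] e d unfolding xseq_eq by simp
      define k where "k = nat \<lfloor>xseq d N2 n - ?e n\<rfloor>"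
      \<comment> \<open>This is the least size above the window, so sizes below \<open>K\<close>
        reach exactly the larger of the two floors.\<close>
      define K where "K = nat (\<lfloor>xseq d N2 n + ?e n\<rfloor> + 1)"
      have k1: "1 \<le> k" and kx: "real k \<le> xseq d N2 n - ?e n"
        unfolding k_def using x1 by linarith+
      have Kx: "real K > xseq d N2 n + ?e n"
        unfolding K_def by linarith
      \<comment> \<open>The lower bound on \<open>N2 n\<close> is used only to fit a k-tuple into
        the second hypergraph: \<open>N2 n\<close> exceeds 3 d! L, which bounds k.\<close>
      have "?L n powr (1/2) \<le> ?L n powr (1 - ?p)"
        using L1 d by (intro powr_mono) (auto simp: field_simps)
      then have "c * ?L n powr (1/2) \<le> c * ?L n powr (1 - ?p)"
        using c(1) by simp
      also have "\<dots> < log 2 (real (N2 n))"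
        using elim(2) L1 by (simp add: pos_less_divide_eq)
      finally have "log 2 (3 * fact d * ?L n) < log 2 (real (N2 n))"
        using elim(3) by linarith
      moreover have "0 < 3 * fact d * ?L n" using L1 by simp
      moreover have "0 < real (N2 n)" using N2[OF n1] by linarith
      ultimately have "3 * fact d * ?L n < real (N2 n)" by simp
      moreover have "real k \<le> 3 * fact d * ?L n"
      proof (rule size_le[OF d L1 lb])
        show "real k \<le> critical d (?l n) + real d / 2"
          using kx eps_bounds(1)[OF d L1 lb(1)] unfolding xseq_eq by linarith
      qed
      ultimately have km: "k \<le> N2 n" by linarith
      show ?case
        unfolding assms(4)[OF n1]
      proof (rule prob_largest_between)
        show "1 - tail d (?L n) \<le> measure_pmf.prob (edge_pmf d n (N2 n)) (?C n k)"
          using kx by (intro prob_below_critical[OF d N2[OF n1] L1 k1 _ km]) (simp add: xseq_eq)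
        show "measure_pmf.prob (edge_pmf d n (N2 n)) (?C n K) \<le> tail d (?L n)"
          using Kx g by (intro prob_above_critical[OF d N2[OF n1] L1]) (simp_all add: xseq_eq)
        show "int j \<in> {\<lfloor>xseq d N2 n - ?e n\<rfloor>, \<lfloor>xseq d N2 n + ?e n\<rfloor>}" if "k \<le> j" "j < K" for j
          using floor_two_point[OF x1 e] that unfolding k_def K_def by blast
      qed
    qed
    then show "whp \<Gamma> (\<lambda>n (\<Gamma>1, \<Gamma>2). int (largest_common_size d \<Gamma>1 \<Gamma>2)
        \<in> {\<lfloor>xseq d N2 n - ?e n\<rfloor>, \<lfloor>xseq d N2 n + ?e n\<rfloor>})"
      by (rule whp_of_eventually_ge[OF _ tail_log2_tendsto[OF d]])
  }
  {
    assume small: "(\<lambda>n. log 2 (real (N2 n))) \<in> o(\<lambda>n. ?L n powr (1 - ?p))"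
      and big: "\<forall>\<^sub>F n in sequentially. int (N2 n) > \<lfloor>yseq d n - ?e n\<rfloor>"
    \<comment> \<open>\<open>\<mu> n\<close> is \<open>xseq - yseq\<close> plus the width of the first case, so that the first moment bound applies
      above \<open>yseq + \<mu>\<close>; for \<open>n = 1\<close> that width is the junk value \<open>0 powr _ = 0\<close>.\<close>
    define \<mu> where "\<mu> n = (if n < 2 then 1 else critical d (?l n) - critical d (?L n) + ?e n)" for n
    have l_eq: "?l n = ?L n + log 2 (real (N2 n))" if "1 \<le> n" for n
      using N2[OF that] that by (simp add: log_mult)
    have gap: "0 \<le> critical d (?l n) - critical d (?L n)"
      "critical d (?l n) - critical d (?L n)
        \<le> fact d powr ?p * (log 2 (real (N2 n)) / ?L n powr (1 - ?p))" if "2 \<le> n" for n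
    proof -
      have "0 < ?L n" "0 \<le> log 2 (real (N2 n))" using that N2[of n] by auto
      from critical_add_le[OF d this]
      show "0 \<le> critical d (?l n) - critical d (?L n)"
        "critical d (?l n) - critical d (?L n)
          \<le> fact d powr ?p * (log 2 (real (N2 n)) / ?L n powr (1 - ?p))"
        using that l_eq[of n] by simp_all
    qed
    have \<mu>_pos: "\<mu> n > 0" for n
    proof (cases "n < 2")
      case False
      then have "0 < ?L n" by simp
      then have "0 < ?e n" by simp
      moreover have "\<mu> n = critical d (?l n) - critical d (?L n) + ?e n"
        using False by (simp add: \<mu>_def)
      moreover have "2 \<le> n" using False by simp
      ultimately show ?thesis using gap(1)[of n] by linarith
    qed (simp add: \<mu>_def)
    have \<mu>_lim: "\<mu> \<longlonglongrightarrow> 0"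
    proof (rule tendsto_sandwich[OF _ _ tendsto_const])
      show "\<forall>\<^sub>F n in sequentially. 0 \<le> \<mu> n"
        using \<mu>_pos by (simp add: less_imp_le)
      show "\<forall>\<^sub>F n in sequentially. \<mu> n \<le>
          fact d powr ?p * (log 2 (real (N2 n)) / ?L n powr (1 - ?p)) + ?e n"
        using eventually_ge_at_top[of 2] by eventually_elim (use gap(2) in \<open>simp add: \<mu>_def\<close>)
      have "- 1 / real d < 0" using d by simp
      then have "?e \<longlonglongrightarrow> 0"
        by (intro tendsto_neg_powr log2_tendsto)
      moreover have "(\<lambda>n. log 2 (real (N2 n)) / ?L n powr (1 - ?p)) \<longlonglongrightarrow> 0"
        using smalloD_tendsto[OF small] .
      ultimately show "(\<lambda>n. fact d powr ?p * (log 2 (real (N2 n)) / ?L n powr (1 - ?p)) + ?e n) \<longlonglongrightarrow> 0"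
        by (intro tendsto_add_zero tendsto_mult_right_zero)
    qed
    have "\<forall>\<^sub>F n in sequentially. \<mu> n < 1/2"
      using \<mu>_lim by (rule order_tendstoD(2)) simp
    then have "\<forall>\<^sub>F n in sequentially. 1 - 2 * tail d (?L n)
        \<le> measure_pmf.prob (\<Gamma> n) {\<omega>. case \<omega> of (\<Gamma>1, \<Gamma>2) \<Rightarrow>
            int (largest_common_size d \<Gamma>1 \<Gamma>2) \<in> {\<lfloor>yseq d n - \<mu> n\<rfloor>, \<lfloor>yseq d n + \<mu> n\<rfloor>}}"
      using eventually_large[OF d] big eventually_ge_at_top[of 2]
    proof eventually_elim
      case (elim n)
      then have n1: "1 \<le> n" and L1: "1 \<le> ?L n" and g: "(real d)\<^sup>2 \<le> gain d (?L n)" and \<mu>2: "\<mu> n < 1/2"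
        by auto
      have \<mu>: "\<mu> n = critical d (?l n) - critical d (?L n) + ?e n"
        using elim(4) by (simp add: \<mu>_def)
      have \<mu>_ge: "?e n \<le> \<mu> n" using gap(1)[OF elim(4)] \<mu> by linarith
      have y1: "1 \<le> yseq d n - \<mu> n"
        using critical_ge_1[OF d L1 order_refl] \<mu>2 d unfolding yseq_eq by simp
      define k where "k = nat \<lfloor>yseq d n - \<mu> n\<rfloor>"
      define K where "K = nat (\<lfloor>yseq d n + \<mu> n\<rfloor> + 1)"
      have k1: "1 \<le> k" and ky: "real k \<le> yseq d n - \<mu> n"
        unfolding k_def using y1 by linarith+
      have Ky: "real K > yseq d n + \<mu> n"
        unfolding K_def by linarith
      \<comment> \<open>As \<mu> is at least the width in the hypothesis on \<open>N2 n\<close>,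
        that hypothesis leaves room for the k-tuple \<open>id\<close>.\<close>
      have "\<lfloor>yseq d n - \<mu> n\<rfloor> \<le> \<lfloor>yseq d n - ?e n\<rfloor>"
        using \<mu>_ge by (intro floor_mono) simp
      then have km: "k \<le> N2 n" using elim(3) unfolding k_def by linarith
      show ?case
        unfolding assms(4)[OF n1]
      proof (rule prob_largest_between)
        have "1 - tail d (?L n) \<le> measure_pmf.prob (edge_pmf d n (N2 n))
            {S. \<exists>I. vertex_tuple (fst (hypergraph_pair n (N2 n) S)) k I \<and>
                induced_subgraph d (fst (hypergraph_pair n (N2 n) S)) k I
                  = induced_subgraph d (snd (hypergraph_pair n (N2 n) S)) k id}"
          using ky \<mu>_ge by (intro prob_initial_segment[OF d N2[OF n1] L1 k1 _ km]) (simp add: yseq_eq)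
        also have "\<dots> \<le> measure_pmf.prob (edge_pmf d n (N2 n)) (?C n k)"
          using initial_segment_common[OF km] by (intro measure_pmf.finite_measure_mono) (blast, simp)
        finally show "1 - tail d (?L n) \<le> measure_pmf.prob (edge_pmf d n (N2 n)) (?C n k)" .
        show "measure_pmf.prob (edge_pmf d n (N2 n)) (?C n K) \<le> tail d (?L n)"
          using Ky g \<mu> by (intro prob_above_critical[OF d N2[OF n1] L1]) (simp_all add: yseq_eq)
        show "int j \<in> {\<lfloor>yseq d n - \<mu> n\<rfloor>, \<lfloor>yseq d n + \<mu> n\<rfloor>}" if "k \<le> j" "j < K" for j
          using floor_two_point[OF y1 \<mu>2] that unfolding k_def K_def by blast
      qed
    qed
    then have "whp \<Gamma> (\<lambda>n (\<Gamma>1, \<Gamma>2). int (largest_common_size d \<Gamma>1 \<Gamma>2)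
        \<in> {\<lfloor>yseq d n - \<mu> n\<rfloor>, \<lfloor>yseq d n + \<mu> n\<rfloor>})"
      by (rule whp_of_eventually_ge[OF _ tail_log2_tendsto[OF d]])
    with \<mu>_pos \<mu>_lim show "\<exists>\<mu> :: nat \<Rightarrow> real. (\<forall>n\<ge>1. \<mu> n > 0) \<and> \<mu> \<longlonglongrightarrow> 0 \<and>
        whp \<Gamma> (\<lambda>n (\<Gamma>1, \<Gamma>2). int (largest_common_size d \<Gamma>1 \<Gamma>2)
          \<in> {\<lfloor>yseq d n - \<mu> n\<rfloor>, \<lfloor>yseq d n + \<mu> n\<rfloor>})"
      by blast
  }
  {
    assume "\<forall>\<^sub>F n in sequentially. int (N2 n) \<le> \<lfloor>yseq d n - ?e n\<rfloor>"
    then have "\<forall>\<^sub>F n in sequentially. 1 - 1 * tail d (?L n)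
        \<le> measure_pmf.prob (\<Gamma> n) {\<omega>. case \<omega> of (\<Gamma>1, \<Gamma>2) \<Rightarrow> is_induced_subgraph d \<Gamma>2 \<Gamma>1}"
      using eventually_large[OF d]
    proof eventually_elim
      case (elim n)
      then have n1: "1 \<le> n" and L1: "1 \<le> ?L n" by auto
      let ?m = "N2 n" and ?M = "edge_pmf d n (N2 n)"
      let ?A = "{S. \<exists>I. vertex_tuple (fst (hypergraph_pair n ?m S)) ?m I \<and>
          induced_subgraph d (fst (hypergraph_pair n ?m S)) ?m I
            = induced_subgraph d (snd (hypergraph_pair n ?m S)) ?m id}"
      have "real ?m \<le> yseq d n - ?e n" using elim(1) by linarith
      then have "1 - tail d (?L n) \<le> measure_pmf.prob ?M ?A"
        by (intro prob_initial_segment[OF d N2[OF n1] L1 N2(1)[OF n1] _ order_refl]) (simp add: yseq_eq)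
      \<comment> \<open>On the support all edges of the second hypergraph are d-subsets of its
        vertices, so \<open>id\<close> induces the whole hypergraph.\<close>
      also have "\<dots> = measure_pmf.prob ?M (?A \<inter> set_pmf ?M)"
        by (rule measure_Int_set_pmf[symmetric])
      also have "\<dots> \<le> measure_pmf.prob ?M
          {S. is_induced_subgraph d (snd (hypergraph_pair n ?m S)) (fst (hypergraph_pair n ?m S))}"
      proof (intro measure_pmf.finite_measure_mono subsetI)
        fix S assume S: "S \<in> ?A \<inter> set_pmf ?M"
        have "card (verts (snd (hypergraph_pair n ?m S))) = ?m"
          by (simp add: hypergraph_pair_def)
        with S induced_subgraph_id[OF edge_pmf_support(2)]
        show "S \<in> {S. is_induced_subgraph d (snd (hypergraph_pair n ?m S)) (fst (hypergraph_pair n ?m S))}"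
          by (auto simp: is_induced_subgraph_def)
      qed simp
      finally show ?case
        unfolding assms(4)[OF n1] prob_pair_uniform_hypergraph by (simp add: case_prod_unfold)
    qed
    then show "whp \<Gamma> (\<lambda>n (\<Gamma>1, \<Gamma>2). is_induced_subgraph d \<Gamma>2 \<Gamma>1)"
      by (rule whp_of_eventually_ge[OF _ tail_log2_tendsto[OF d]])
  }
qed

end
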